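(* Let $(R,\mathfrak{m})$ be a Cohen-Macaulay local ring and let $X$ and $Y$ be non-empty subsets of $\operatorname{Ass}_R(R)$ such that $\operatorname{Ass}_R(R)=X\cup Y$ and $X\cap Y=\emptyset$. Set $I=\bigcap_{\mathfrak{p}\in X}\mathfrak{p}$ and $J=\bigcap_{\mathfrak{p}\in Y}\mathfrak{p}$. Then $R/(I+J)$ is an equidimensional local ring of dimension $\dim R-1$.
   Context: Rings are commutative with identity and Noetherian. $\operatorname{Ass}_R(R)$ is the set of associated prime ideals of $R$. A Noetherian ring $A$ of finite Krull dimension $d$ is called equidimensional if $\dim A/\mathfrak{p}=d$ for every minimal prime ideal $\mathfrak{p}$ of $A$. *)

theory Defs
  imports "HOL-Algebra.Algebra" "HOL-Library.Extended_Real"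
begin

definition noetherian_local_ring :: "('a, 'b) ring_scheme \<Rightarrow> 'a set \<Rightarrow> bool" where
  "noetherian_local_ring R m \<longleftrightarrow>
     cring R \<and> noetherian_ring R \<and> maximalideal m R \<and> (\<forall>n. maximalideal n R \<longrightarrow> n = m)"

definition ann :: "('a, 'b) ring_scheme \<Rightarrow> 'a \<Rightarrow> 'a set" where
  "ann R x = {r \<in> carrier R. r \<otimes>\<^bsub>R\<^esub> x = \<zero>\<^bsub>R\<^esub>}"

definition Ass :: "('a, 'b) ring_scheme \<Rightarrow> 'a set set" where
  "Ass R = {p. primeideal p R \<and> (\<exists>x\<in>carrier R. p = ann R x)}"

definition minimal_primes :: "('a, 'b) ring_scheme \<Rightarrow> 'a set set" where
  "minimal_primes R = {p. primeideal p R \<and> (\<forall>q. primeideal q R \<and> q \<subseteq> p \<longrightarrow> q = p)}"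

definition prime_chain :: "('a, 'b) ring_scheme \<Rightarrow> (nat \<Rightarrow> 'a set) \<Rightarrow> nat \<Rightarrow> bool" where
  "prime_chain R p n \<longleftrightarrow> (\<forall>i\<le>n. primeideal (p i) R) \<and> (\<forall>i<n. p i \<subset> p (Suc i))"

text \<open>The supremum is taken in \<^typ>\<open>ereal\<close>, so that the zero ring has dimension \<open>-\<infinity>\<close> and
  subtraction of 1 is not truncated.\<close>

definition krull_dim :: "('a, 'b) ring_scheme \<Rightarrow> ereal" where
  "krull_dim R = Sup {ereal (real n) | n. \<exists>p. prime_chain R p n}"

definition nonzerodivisor :: "('a, 'b) ring_scheme \<Rightarrow> 'a \<Rightarrow> bool" where
  "nonzerodivisor R a \<longleftrightarrow>
     a \<in> carrier R \<and> (\<forall>b\<in>carrier R. a \<otimes>\<^bsub>R\<^esub> b = \<zero>\<^bsub>R\<^esub> \<longrightarrow> b = \<zero>\<^bsub>R\<^esub>)"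

definition regular_sequence :: "('a, 'b) ring_scheme \<Rightarrow> 'a list \<Rightarrow> bool" where
  "regular_sequence R xs \<longleftrightarrow>
     set xs \<subseteq> carrier R \<and>
     (\<forall>i<length xs. nonzerodivisor (R Quot (Idl\<^bsub>R\<^esub> (set (take i xs))))
                                   ((Idl\<^bsub>R\<^esub> (set (take i xs))) +>\<^bsub>R\<^esub> (xs ! i))) \<and>
     Idl\<^bsub>R\<^esub> (set xs) \<noteq> carrier R"

text \<open>Over a Noetherian local ring all maximal regular sequences in \<open>m\<close> have the same length,
  so this supremum is the usual depth.\<close>

definition depth :: "('a, 'b) ring_scheme \<Rightarrow> 'a set \<Rightarrow> ereal" where
  "depth R m = Sup {ereal (real (length xs)) | xs. set xs \<subseteq> m \<and> regular_sequence R xs}"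

definition cohen_macaulay_local_ring :: "('a, 'b) ring_scheme \<Rightarrow> 'a set \<Rightarrow> bool" where
  "cohen_macaulay_local_ring R m \<longleftrightarrow> noetherian_local_ring R m \<and> depth R m = krull_dim R"

definition equidimensional :: "('a, 'b) ring_scheme \<Rightarrow> bool" where
  "equidimensional A \<longleftrightarrow>
     cring A \<and> noetherian_ring A \<and>
     (\<exists>d::nat. krull_dim A = ereal (real d) \<and>
        (\<forall>p\<in>minimal_primes A. krull_dim (A Quot p) = ereal (real d)))"

end

theory Submission
  imports Defs
begin

text \<open>
  Let \<open>d\<close> be the dimension of \<open>R\<close>.  Two facts about a Cohen--Macaulay local ring enter: chains of
  primes of length \<open>d\<close> start at every associated prime of \<open>0\<close>, and chains of length \<open>d - 1\<close> start
  at every associated prime of \<open>(a)\<close> when \<open>a \<in> m\<close> is regular.  The first makes all associated primes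
  of \<open>0\<close> minimal, hence pairwise incomparable, so that a prime over \<open>I + J\<close>, which contains a member
  of \<open>\<XX>\<close> and a member of \<open>\<YY>\<close>, is not minimal; chains above \<open>I + J\<close> therefore have length at
  most \<open>d - 1\<close>.

  For the opposite inequality let \<open>P\<close> be minimal over \<open>I + J\<close>.  It lies in no associated prime, hence
  contains a regular element \<open>a\<close> by prime avoidance.  Hartshorne's connectedness argument shows that
  \<open>P\<close> contains no regular sequence \<open>a, b\<close> (\<open>no_regular_pair_in_prime\<close>), so \<open>P\<close> consists of zero
  divisors modulo \<open>a\<close> and lies in an associated prime of \<open>(a)\<close>, above which there is a chain of
  length \<open>d - 1\<close>.

  The connectedness argument: choose ideals \<open>I', J'\<close> with \<open>I' J' = 0\<close> and the same minimal primes as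
  \<open>I\<close> and \<open>J\<close>.  Up to a factor \<open>s\<close> outside \<open>P\<close>, powers of \<open>a\<close> and \<open>b\<close> lie in \<open>I' + J'\<close>, say
  \<open>s a = a1 + a2\<close> and \<open>s b = b1 + b2\<close> after renaming the powers.  Both \<open>s b a1\<close> and \<open>s a b1\<close> equal
  \<open>a1 b1\<close>, so \<open>b\<close> being regular modulo \<open>a\<close> gives \<open>s a1 = c a\<close>, likewise \<open>s a2 = e a\<close>, and
  \<open>s\<^sup>2 = c + e\<close>.  One of \<open>c\<close>, \<open>e\<close> is outside \<open>P\<close>; as \<open>c\<close> kills \<open>J'\<close> and \<open>e\<close> kills \<open>I'\<close>, one of
  these ideals lies in a minimal prime of the other part, which incomparability forbids.

  The two facts about chains follow from one step (\<open>assoc_prime_step\<close>): an associated prime of \<open>K\<close> is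
  strictly contained in one of \<open>K + (x)\<close> when \<open>x\<close> is regular modulo \<open>K\<close>.  For the associated primes
  of \<open>(a)\<close> this needs a regular sequence of length \<open>d\<close> that starts with the prescribed \<open>a\<close>; it is
  supplied by the exchange lemma \<open>regular_seq_exchange\<close>, which also shows that the depth is
  finite and attained.
\<close>

section \<open>Ideals, colon ideals and regularity modulo an ideal\<close>

context cring
begin

lemma ideal_subset_carrier: "ideal K R \<Longrightarrow> K \<subseteq> carrier R"
  by (simp add: additive_subgroup.a_subset ideal.axioms(1))

lemma ideal_mem_carrier: "ideal K R \<Longrightarrow> a \<in> K \<Longrightarrow> a \<in> carrier R"
  using ideal_subset_carrier by blast

lemma ideal_zero: "ideal K R \<Longrightarrow> \<zero> \<in> K"
  by (simp add: additive_subgroup.zero_closed ideal.axioms(1))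

lemma ideal_add: "ideal K R \<Longrightarrow> a \<in> K \<Longrightarrow> b \<in> K \<Longrightarrow> a \<oplus> b \<in> K"
  by (simp add: additive_subgroup.a_closed ideal.axioms(1))

lemma ideal_neg: "ideal K R \<Longrightarrow> a \<in> K \<Longrightarrow> \<ominus> a \<in> K"
  by (simp add: additive_subgroup.a_inv_closed ideal.axioms(1))

lemma ideal_minus: "ideal K R \<Longrightarrow> a \<in> K \<Longrightarrow> b \<in> K \<Longrightarrow> a \<ominus> b \<in> K"
  by (simp add: a_minus_def ideal_add ideal_neg)

lemma ideal_l_mult: "ideal K R \<Longrightarrow> a \<in> K \<Longrightarrow> r \<in> carrier R \<Longrightarrow> r \<otimes> a \<in> K"
  by (simp add: ideal.I_l_closed)

lemma ideal_r_mult: "ideal K R \<Longrightarrow> a \<in> K \<Longrightarrow> r \<in> carrier R \<Longrightarrow> a \<otimes> r \<in> K"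
  by (simp add: ideal.I_r_closed)

lemma idealI_closed:
  assumes "S \<subseteq> carrier R" "\<zero> \<in> S"
    and add: "\<And>a b. a \<in> S \<Longrightarrow> b \<in> S \<Longrightarrow> a \<oplus> b \<in> S"
    and mult: "\<And>a r. a \<in> S \<Longrightarrow> r \<in> carrier R \<Longrightarrow> r \<otimes> a \<in> S"
  shows "ideal S R"
proof (rule idealI)
  show "ring R" by (rule ring_axioms)
  show "subgroup S (add_monoid R)"
  proof (rule subgroup.intro)
    fix a assume a: "a \<in> S"
    then have "(\<ominus> \<one>) \<otimes> a \<in> S" using mult by simp
    moreover have "(\<ominus> \<one>) \<otimes> a = \<ominus> a" using a assms(1) by (simp add: l_minus subset_iff)
    ultimately show "inv\<^bsub>add_monoid R\<^esub> a \<in> S" by (simp add: a_inv_def)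
  qed (use assms in auto)
  fix a x assume ax: "a \<in> S" "x \<in> carrier R"
  then show "x \<otimes> a \<in> S" using mult by simp
  then show "a \<otimes> x \<in> S" using ax assms(1) by (metis m_comm subsetD)
qed

lemma ideal_eq_carrier_iff: "ideal K R \<Longrightarrow> K = carrier R \<longleftrightarrow> \<one> \<in> K"
  using ideal.one_imp_carrier by auto

lemma prime_not_one: "primeideal p R \<Longrightarrow> \<one> \<notin> p"
  using ideal_eq_carrier_iff primeideal.axioms(1) primeideal.I_notcarr by metis

lemma prime_mult_mem:
  "primeideal p R \<Longrightarrow> a \<in> carrier R \<Longrightarrow> b \<in> carrier R \<Longrightarrow> a \<otimes> b \<in> p \<Longrightarrow> a \<in> p \<or> b \<in> p"
  by (rule primeideal.I_prime)

text \<open>This is the annihilator of the class of \<open>y\<close> in the quotient by \<open>K\<close>.  Properties of quotients are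
  expressed by membership in ideals of the one ring \<open>R\<close>: iterated quotients have ever different
  element types, which rules out induction along a regular sequence.\<close>

definition colon :: "'a set \<Rightarrow> 'a \<Rightarrow> 'a set"
  where "colon K y = {r \<in> carrier R. r \<otimes> y \<in> K}"

definition adjoin :: "'a set \<Rightarrow> 'a \<Rightarrow> 'a set"
  where "adjoin K x = K <+> PIdl x"

definition regular_mod :: "'a set \<Rightarrow> 'a \<Rightarrow> bool"
  where "regular_mod K x \<longleftrightarrow> x \<in> carrier R \<and> (\<forall>y\<in>carrier R. x \<otimes> y \<in> K \<longrightarrow> y \<in> K)"

definition assoc_primes :: "'a set \<Rightarrow> 'a set set"
  where "assoc_primes K = {p. primeideal p R \<and> (\<exists>y\<in>carrier R. p = colon K y)}"

lemma colon_ideal: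
  assumes K: "ideal K R" and y: "y \<in> carrier R"
  shows "ideal (colon K y) R"
  using y by (intro idealI_closed)
    (auto simp: colon_def l_distr m_assoc ideal_add[OF K] ideal_zero[OF K] ideal_l_mult[OF K])

lemma colon_eq_carrier_iff:
  assumes "ideal K R" "y \<in> carrier R"
  shows "colon K y = carrier R \<longleftrightarrow> y \<in> K"
  using assms unfolding ideal_eq_carrier_iff[OF colon_ideal[OF assms]] by (auto simp: colon_def)

lemma adjoin_iff:
  assumes K: "ideal K R" and x: "x \<in> carrier R"
  shows "v \<in> adjoin K x \<longleftrightarrow> v \<in> carrier R \<and> (\<exists>r\<in>carrier R. v \<ominus> r \<otimes> x \<in> K)"
proof
  assume "v \<in> adjoin K x"
  then obtain k r where *: "k \<in> K" "r \<in> carrier R" "v = k \<oplus> r \<otimes> x"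
    by (auto simp: adjoin_def set_add_def' cgenideal_def)
  moreover have k: "k \<in> carrier R" using * ideal_mem_carrier[OF K] by blast
  moreover have "v \<ominus> r \<otimes> x = k" using * k x by algebra
  ultimately show "v \<in> carrier R \<and> (\<exists>r\<in>carrier R. v \<ominus> r \<otimes> x \<in> K)" using x
    by (intro conjI bexI[of _ r]) auto
next
  assume "v \<in> carrier R \<and> (\<exists>r\<in>carrier R. v \<ominus> r \<otimes> x \<in> K)"
  then obtain r where *: "v \<in> carrier R" "r \<in> carrier R" "v \<ominus> r \<otimes> x \<in> K" by blast
  moreover have "v = (v \<ominus> r \<otimes> x) \<oplus> r \<otimes> x" using * x by algebra
  ultimately show "v \<in> adjoin K x"
    unfolding adjoin_def set_add_def' cgenideal_def by blast
qed

lemma adjoin_ideal: "ideal K R \<Longrightarrow> x \<in> carrier R \<Longrightarrow> ideal (adjoin K x) R"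
  by (simp add: adjoin_def add_ideals cgenideal_ideal)

lemma subset_adjoin: "ideal K R \<Longrightarrow> x \<in> carrier R \<Longrightarrow> K \<subseteq> adjoin K x"
  by (auto simp: adjoin_iff ideal_mem_carrier intro!: bexI[of _ \<zero>]) (simp add: a_minus_def ideal_mem_carrier)

lemma mem_adjoin: "ideal K R \<Longrightarrow> x \<in> carrier R \<Longrightarrow> x \<in> adjoin K x"
  by (auto simp: adjoin_iff r_neg a_minus_def ideal_zero intro!: bexI[of _ \<one>])

lemma adjoin_minimal:
  assumes "ideal K R" "x \<in> carrier R" "ideal L R" "K \<subseteq> L" "x \<in> L"
  shows "adjoin K x \<subseteq> L"
proof
  fix v assume "v \<in> adjoin K x"
  then obtain r where *: "v \<in> carrier R" "r \<in> carrier R" "v \<ominus> r \<otimes> x \<in> L"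
    using assms by (auto simp: adjoin_iff)
  then have "(v \<ominus> r \<otimes> x) \<oplus> r \<otimes> x \<in> L"
    using assms by (intro ideal_add ideal_l_mult) auto
  moreover have "(v \<ominus> r \<otimes> x) \<oplus> r \<otimes> x = v" using * assms(2) by algebra
  ultimately show "v \<in> L" by simp
qed

lemma adjoin_commute:
  assumes "ideal K R" "x \<in> carrier R" "z \<in> carrier R"
  shows "adjoin (adjoin K x) z = adjoin (adjoin K z) x"
proof -
  have "adjoin (adjoin K a) b \<subseteq> adjoin (adjoin K b) a" if "a \<in> carrier R" "b \<in> carrier R" for a b
  proof (rule adjoin_minimal)
    show "ideal (adjoin (adjoin K b) a) R" by (intro adjoin_ideal assms(1) that)
    have "adjoin K b \<subseteq> adjoin (adjoin K b) a"
      by (intro subset_adjoin adjoin_ideal assms(1) that)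
    then show "b \<in> adjoin (adjoin K b) a"
      using mem_adjoin[OF assms(1) that(2)] by blast
    have "K \<subseteq> adjoin (adjoin K b) a"
      using subset_adjoin[OF assms(1) that(2)] \<open>adjoin K b \<subseteq> _\<close> by blast
    then show "adjoin K a \<subseteq> adjoin (adjoin K b) a"
      by (intro adjoin_minimal adjoin_ideal assms(1) that mem_adjoin)
  qed (intro adjoin_ideal assms(1) that)+
  then show ?thesis using assms by blast
qed

lemma PIdl_iff: "v \<in> PIdl x \<longleftrightarrow> (\<exists>r\<in>carrier R. v = r \<otimes> x)"
  by (auto simp: cgenideal_def)

lemma regular_modD: "regular_mod K x \<Longrightarrow> y \<in> carrier R \<Longrightarrow> x \<otimes> y \<in> K \<Longrightarrow> y \<in> K"
  by (simp add: regular_mod_def)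

text \<open>If \<open>x y = w z\<close> modulo \<open>K\<close>, regularity of \<open>z\<close> modulo \<open>K + (x)\<close> gives \<open>w = r x\<close>, and
  cancelling \<open>x\<close> gives \<open>y = r z\<close>.\<close>

lemma regular_mod_swap:
  assumes K: "ideal K R" and x: "regular_mod K x" and z: "regular_mod (adjoin K x) z"
  shows "regular_mod (adjoin K z) x"
proof -
  have c: "x \<in> carrier R" "z \<in> carrier R" using x z by (auto simp: regular_mod_def)
  have "y \<in> adjoin K z" if y: "y \<in> carrier R" "x \<otimes> y \<in> adjoin K z" for y
  proof -
    obtain w where w: "w \<in> carrier R" "x \<otimes> y \<ominus> w \<otimes> z \<in> K"
      using y adjoin_iff[OF K c(2)] by auto
    have "z \<otimes> w \<ominus> y \<otimes> x = \<ominus> (x \<otimes> y \<ominus> w \<otimes> z)" using c y w(1) by algebra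
    then have "z \<otimes> w \<in> adjoin K x"
      unfolding adjoin_iff[OF K c(1)] using w y c ideal_neg[OF K w(2)]
      by (intro conjI bexI[of _ y]) auto
    then have "w \<in> adjoin K x" using regular_modD[OF z] w by blast
    then obtain r where r: "r \<in> carrier R" "w \<ominus> r \<otimes> x \<in> K" by (auto simp: adjoin_iff[OF K c(1)])
    have "x \<otimes> (y \<ominus> r \<otimes> z) = (x \<otimes> y \<ominus> w \<otimes> z) \<oplus> z \<otimes> (w \<ominus> r \<otimes> x)"
      using c y w(1) r(1) by algebra
    then have "x \<otimes> (y \<ominus> r \<otimes> z) \<in> K"
      using w r c by (simp add: ideal_add[OF K] ideal_l_mult[OF K])
    then have "y \<ominus> r \<otimes> z \<in> K" using regular_modD[OF x] y r c by simp
    then show ?thesis using y r adjoin_iff[OF K c(2)] by auto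
  qed
  then show ?thesis using c by (simp add: regular_mod_def)
qed

lemma regular_mod_pow:
  assumes K: "ideal K R" and x: "regular_mod K x"
  shows "regular_mod K (x [^] (n::nat))"
proof (induction n)
  case 0
  then show ?case by (simp add: regular_mod_def)
next
  case (Suc n)
  have c: "x \<in> carrier R" using x by (simp add: regular_mod_def)
  have "y \<in> K" if "y \<in> carrier R" "x [^] n \<otimes> x \<otimes> y \<in> K" for y
    using regular_modD[OF x that(1)] regular_modD[OF Suc, of "x \<otimes> y"] that c by (simp add: m_assoc)
  then show ?case using c by (simp add: regular_mod_def)
qed

text \<open>Induction step: from \<open>b y = u a\<^sup>n\<^sup>+\<^sup>1\<close> regularity modulo \<open>a\<close> gives \<open>y = w a\<close>, and cancelling
  \<open>a\<close> leaves \<open>b w = u a\<^sup>n\<close>.\<close>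

lemma regular_mod_PIdl_pow:
  assumes a: "regular_mod {\<zero>} a" and b: "regular_mod (PIdl a) b"
  shows "regular_mod (PIdl (a [^] (n::nat))) b"
proof (induction n)
  case 0
  have "PIdl \<one> = carrier R" by (force simp: cgenideal_def)
  then show ?case using b by (simp add: regular_mod_def)
next
  case (Suc n)
  have c: "a \<in> carrier R" "b \<in> carrier R" using a b by (auto simp: regular_mod_def)
  have "y \<in> PIdl (a [^] Suc n)" if y: "y \<in> carrier R" and bdvd: "b \<otimes> y \<in> PIdl (a [^] Suc n)" for y
  proof -
    obtain u where u: "u \<in> carrier R" "b \<otimes> y = u \<otimes> (a [^] n \<otimes> a)"
      using bdvd by (auto simp: PIdl_iff)
    have "b \<otimes> y = (u \<otimes> a [^] n) \<otimes> a" using u c by (simp add: m_assoc)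
    then have "b \<otimes> y \<in> PIdl a" unfolding PIdl_iff using u c by (intro bexI[of _ "u \<otimes> a [^] n"]) auto
    then have "y \<in> PIdl a" using regular_modD[OF b y] by blast
    then obtain w where w: "w \<in> carrier R" "y = w \<otimes> a" by (auto simp: PIdl_iff)
    have an: "a [^] n \<in> carrier R" using c by simp
    have "a \<otimes> (b \<otimes> w \<ominus> u \<otimes> a [^] n) = b \<otimes> y \<ominus> u \<otimes> (a [^] n \<otimes> a)"
      unfolding w(2) using c u(1) w(1) an by algebra
    also have "\<dots> = \<zero>" using u c an by (simp add: a_minus_def r_neg)
    finally have "b \<otimes> w \<ominus> u \<otimes> a [^] n = \<zero>"
      using regular_modD[OF a, of "b \<otimes> w \<ominus> u \<otimes> a [^] n"] c u(1) w(1) an by simp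
    then have "b \<otimes> w = u \<otimes> a [^] n" using c u(1) w(1) an by simp
    then have "b \<otimes> w \<in> PIdl (a [^] n)" using u by (auto simp: PIdl_iff)
    then have "w \<in> PIdl (a [^] n)" using regular_modD[OF Suc w(1)] by blast
    then obtain t where t: "t \<in> carrier R" "w = t \<otimes> a [^] n" by (auto simp: PIdl_iff)
    then have "y = t \<otimes> a [^] Suc n" using w(2) c an by (simp add: m_assoc)
    then show ?thesis using t(1) by (auto simp: PIdl_iff)
  qed
  then show ?case using c by (simp add: regular_mod_def)
qed

lemma adjoin_zero:
  assumes "x \<in> carrier R" shows "adjoin {\<zero>} x = PIdl x"
proof -
  have "{\<zero>} <+> PIdl x = (\<Union>k\<in>PIdl x. {\<zero> \<oplus> k})" by (simp add: set_add_def')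
  also have "\<dots> = (\<Union>k\<in>PIdl x. {k})"
    using ideal_mem_carrier[OF cgenideal_ideal[OF assms]] by (intro SUP_cong) auto
  finally show ?thesis by (simp add: adjoin_def)
qed

end

section \<open>Associated primes of an ideal in a Noetherian ring\<close>

context cring
begin

lemma prime_contains_of_Inter:
  assumes p: "primeideal p R" and "finite F" "\<And>q. q \<in> F \<Longrightarrow> ideal q R" "carrier R \<inter> \<Inter>F \<subseteq> p"
  shows "\<exists>q\<in>F. q \<subseteq> p"
  using assms(2-)
proof (induction F rule: finite_induct)
  case empty
  then show ?case using prime_not_one[OF p] by auto
next
  case (insert q F)
  show ?case
  proof (rule ccontr)
    assume "\<not> ?case"
    then have "\<not> q \<subseteq> p" "\<not> carrier R \<inter> \<Inter>F \<subseteq> p" using insert.IH insert.prems(1) by auto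
    then obtain a b where a: "a \<in> q" "a \<notin> p" and b: "b \<in> carrier R" "b \<in> \<Inter>F" "b \<notin> p"
      by blast
    have q: "ideal q R" using insert by simp
    have "a \<in> carrier R" using ideal_mem_carrier[OF q] a by blast
    moreover have "a \<otimes> b \<in> \<Inter>F"
      using b ideal_l_mult[of _ b a] insert.prems(1) calculation by blast
    moreover have "a \<otimes> b \<in> q" using ideal_r_mult[OF q a(1) b(1)] .
    ultimately have "a \<otimes> b \<in> p" using insert.prems(2) b by auto
    then show False using prime_mult_mem[OF p] a b \<open>a \<in> carrier R\<close> by blast
  qed
qed

lemma prime_avoidance:
  assumes A: "ideal A R" and "finite S" "\<And>p. p \<in> S \<Longrightarrow> primeideal p R" "\<And>p. p \<in> S \<Longrightarrow> \<not> A \<subseteq> p"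
  obtains a where "a \<in> A" "a \<notin> \<Union>S"
proof -
  have "\<exists>a\<in>A. a \<notin> \<Union>S" using assms(2-)
  proof (induction S rule: finite_psubset_induct)
    case (psubset S)
    have primes: "primeideal p R" "\<not> A \<subseteq> p" if "p \<in> S" for p using psubset that by auto
    consider "S = {}" | p q where "p \<in> S" "q \<in> S" "p \<noteq> q" "q \<subseteq> p"
      | p where "p \<in> S" "\<forall>q\<in>S - {p}. \<not> q \<subseteq> p" by blast
    then show ?case
    proof cases
      case 1
      then show ?thesis using ideal_zero[OF A] by auto
    next
      case 2
      then have "\<exists>a\<in>A. a \<notin> \<Union>(S - {q})" using psubset by (intro psubset.IH) auto
      then show ?thesis using 2 by blast
    next
      case 3
      then have "\<exists>a\<in>A. a \<notin> \<Union>(S - {p})" using psubset by (intro psubset.IH) auto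
      then obtain a where a: "a \<in> A" "a \<notin> \<Union>(S - {p})" by blast
      show ?thesis
      proof (cases "a \<in> p")
        case False
        then show ?thesis using a by blast
      next
        case True
        \<comment> \<open>correct \<open>a\<close> by an element of all the other primes that is not in \<open>p\<close>\<close>
        have p: "primeideal p R" "ideal p R" using primes 3(1) primeideal.axioms(1) by auto
        have "\<not> carrier R \<inter> \<Inter>(insert A (S - {p})) \<subseteq> p"
        proof
          assume "carrier R \<inter> \<Inter>(insert A (S - {p})) \<subseteq> p"
          then have "\<exists>q\<in>insert A (S - {p}). q \<subseteq> p"
            using A primes(1) psubset.hyps
            by (intro prime_contains_of_Inter[OF p(1)]) (auto intro: primeideal.axioms(1))
          then show False using 3 primes(2)[OF 3(1)] by blast
        qed
        then obtain b where b: "b \<in> A" "b \<in> \<Inter>(S - {p})" "b \<notin> p" by auto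
        have c: "a \<in> carrier R" "b \<in> carrier R" using a b ideal_mem_carrier[OF A] by auto
        have "a \<oplus> b \<notin> p"
        proof
          assume "a \<oplus> b \<in> p"
          then have "(a \<oplus> b) \<ominus> a \<in> p" using True by (intro ideal_minus[OF p(2)])
          moreover have "(a \<oplus> b) \<ominus> a = b" using c by algebra
          ultimately show False using b by simp
        qed
        moreover have "a \<oplus> b \<notin> q" if q: "q \<in> S - {p}" for q
        proof
          assume "a \<oplus> b \<in> q"
          moreover have "b \<in> q" using b q by blast
          ultimately have "(a \<oplus> b) \<ominus> b \<in> q"
            using primes(1) q by (intro ideal_minus) (auto intro: primeideal.axioms(1))
          moreover have "(a \<oplus> b) \<ominus> b = a" using c by algebra
          ultimately show False using a q by auto
        qed
        ultimately show ?thesis using ideal_add[OF A a(1) b(1)] by blast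
      qed
    qed
  qed
  then show ?thesis using that by blast
qed

text \<open>The maximal annihilators of nonzero elements of the quotient by \<open>K\<close>: finitely many associated
  primes whose union is the set of all zero divisors, so that prime avoidance applies to them.\<close>

definition maximal_colons :: "'a set \<Rightarrow> 'a set set"
  where "maximal_colons K = {p. \<exists>y\<in>carrier R - K. p = colon K y \<and>
           (\<forall>z\<in>carrier R - K. colon K y \<subseteq> colon K z \<longrightarrow> colon K z = colon K y)}"

text \<open>If \<open>a b\<close> kills \<open>y\<close> and \<open>b\<close> does not, then \<open>a\<close> kills \<open>b y\<close>, whose annihilator is that of \<open>y\<close>
  by maximality.\<close>

lemma maximal_colons_assoc:
  assumes K: "ideal K R"
  shows "maximal_colons K \<subseteq> assoc_primes K"
proof
  fix p assume "p \<in> maximal_colons K"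
  then obtain y where y: "y \<in> carrier R" "y \<notin> K" "p = colon K y"
    and max: "\<And>z. z \<in> carrier R - K \<Longrightarrow> colon K y \<subseteq> colon K z \<Longrightarrow> colon K z = colon K y"
    unfolding maximal_colons_def by blast
  have "primeideal p R"
  proof (rule primeidealI)
    show "ideal p R" using y colon_ideal[OF K] by simp
    show "cring R" by (rule cring_axioms)
    show "carrier R \<noteq> p" using colon_eq_carrier_iff[OF K] y by metis
    fix a b assume ab: "a \<in> carrier R" "b \<in> carrier R" "a \<otimes> b \<in> p"
    show "a \<in> p \<or> b \<in> p"
    proof (cases "b \<otimes> y \<in> K")
      case True
      then show ?thesis using ab y by (simp add: colon_def)
    next
      case False
      have "colon K y \<subseteq> colon K (b \<otimes> y)"
        using y ab K by (auto simp: colon_def m_lcomm[of _ b] ideal_l_mult)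
      then have "colon K (b \<otimes> y) = p" using max[of "b \<otimes> y"] False ab y by simp
      moreover have "a \<in> colon K (b \<otimes> y)" using ab y by (simp add: colon_def m_assoc)
      ultimately show ?thesis by blast
    qed
  qed
  then show "p \<in> assoc_primes K" using y by (auto simp: assoc_primes_def)
qed

lemma assoc_prime_ideal: "p \<in> assoc_primes K \<Longrightarrow> primeideal p R"
  by (simp add: assoc_primes_def)

end

locale noetherian_cring = noetherian_ring + cring
begin

lemma maximal_ideal_in_family:
  assumes "S \<noteq> {}" and ideals: "\<And>I. I \<in> S \<Longrightarrow> ideal I R"
  obtains M where "M \<in> S" "\<And>N. N \<in> S \<Longrightarrow> M \<subseteq> N \<Longrightarrow> N = M"
proof -
  have "\<Union>C \<in> S" if "C \<noteq> {}" "subset.chain S C" for C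
  proof -
    have "subset.chain {I. ideal I R} C"
      using that(2) ideals by (auto simp: subset.chain_def)
    then have "\<Union>C \<in> C" using ideal_chain_is_trivial that(1) by blast
    then show ?thesis using that(2) by (auto simp: subset.chain_def)
  qed
  then show ?thesis using subset_Zorn_nonempty[OF assms(1)] that by metis
qed

lemma colon_subset_maximal_colon:
  assumes K: "ideal K R" and y: "y \<in> carrier R" "y \<notin> K"
  obtains p where "p \<in> maximal_colons K" "colon K y \<subseteq> p"
proof -
  let ?S = "{colon K z |z. z \<in> carrier R - K \<and> colon K y \<subseteq> colon K z}"
  obtain M where M: "M \<in> ?S" "\<And>N. N \<in> ?S \<Longrightarrow> M \<subseteq> N \<Longrightarrow> N = M"
    using maximal_ideal_in_family[of ?S] y colon_ideal[OF K] by blast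
  then obtain z where z: "M = colon K z" "z \<in> carrier R - K" "colon K y \<subseteq> colon K z" by blast
  have "\<forall>w\<in>carrier R - K. colon K z \<subseteq> colon K w \<longrightarrow> colon K w = colon K z"
    using M(2) z by blast
  then have "M \<in> maximal_colons K" using z unfolding maximal_colons_def by blast
  then show ?thesis using that z by blast
qed

lemma colon_subset_assoc_prime:
  assumes "ideal K R" "y \<in> carrier R" "y \<notin> K"
  obtains p where "p \<in> assoc_primes K" "colon K y \<subseteq> p"
  using colon_subset_maximal_colon[OF assms] maximal_colons_assoc[OF assms(1)] by blast

text \<open>The elements killed by the intersection of a finite set \<open>F\<close> of maximal annihilators form an
  ideal that grows with \<open>F\<close>.  Where it is largest, the intersection of \<open>F\<close> lies in every maximal
  annihilator, so each of them contains, and hence equals, a member of \<open>F\<close>.\<close>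

lemma finite_maximal_colons:
  assumes K: "ideal K R"
  shows "finite (maximal_colons K)"
proof -
  define B where "B F = {z \<in> carrier R. \<forall>r\<in>carrier R \<inter> \<Inter>F. r \<otimes> z \<in> K}" for F
  have B: "ideal (B F) R" for F
    by (intro idealI_closed)
      (auto simp: B_def r_distr m_lcomm ideal_zero[OF K] ideal_add[OF K] ideal_l_mult[OF K])
  let ?S = "{B F |F. finite F \<and> F \<subseteq> maximal_colons K}"
  obtain M where M: "M \<in> ?S" "\<And>N. N \<in> ?S \<Longrightarrow> M \<subseteq> N \<Longrightarrow> N = M"
    using maximal_ideal_in_family[of ?S] B by blast
  then obtain F where F: "M = B F" "finite F" "F \<subseteq> maximal_colons K" by blast
  have "p \<in> F" if p: "p \<in> maximal_colons K" for p
  proof -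
    obtain y where y: "y \<in> carrier R" "p = colon K y" using p by (auto simp: maximal_colons_def)
    have "B (insert p F) \<in> ?S" using F p by blast
    moreover have "B F \<subseteq> B (insert p F)" by (auto simp: B_def)
    ultimately have "B (insert p F) = B F" using M(2) F(1) by blast
    moreover have "y \<in> B (insert p F)" using y by (auto simp: B_def colon_def)
    ultimately have "y \<in> B F" by simp
    then have "carrier R \<inter> \<Inter>F \<subseteq> p" using y by (auto simp: B_def colon_def)
    moreover have "primeideal p R" "\<And>q. q \<in> F \<Longrightarrow> primeideal q R"
      using p F(3) maximal_colons_assoc[OF K] assoc_prime_ideal by blast+
    ultimately obtain q where q: "q \<in> F" "q \<subseteq> p"
      using prime_contains_of_Inter[OF _ F(2)] primeideal.axioms(1) by metis
    then obtain z where "z \<in> carrier R - K" "q = colon K z"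
       "\<forall>w\<in>carrier R - K. colon K z \<subseteq> colon K w \<longrightarrow> colon K w = colon K z"
      using F(3) unfolding maximal_colons_def by blast
    moreover have "y \<notin> K"
      using y colon_eq_carrier_iff[OF K y(1)] prime_not_one[OF \<open>primeideal p R\<close>] by auto
    ultimately have "p = q" using q y by blast
    then show ?thesis using q by simp
  qed
  then have "maximal_colons K \<subseteq> F" by blast
  then show ?thesis using F(2) by (rule finite_subset)
qed

lemma regular_mod_iff_maximal_colons:
  assumes K: "ideal K R"
  shows "regular_mod K x \<longleftrightarrow> x \<in> carrier R \<and> x \<notin> \<Union>(maximal_colons K)"
proof
  assume x: "regular_mod K x"
  have "x \<notin> p" if "p \<in> maximal_colons K" for p
  proof -
    obtain y where "y \<in> carrier R - K" "p = colon K y"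
      using \<open>p \<in> _\<close> unfolding maximal_colons_def by blast
    then show ?thesis using regular_modD[OF x, of y] by (auto simp: colon_def)
  qed
  then show "x \<in> carrier R \<and> x \<notin> \<Union>(maximal_colons K)" using x by (auto simp: regular_mod_def)
next
  assume x: "x \<in> carrier R \<and> x \<notin> \<Union>(maximal_colons K)"
  have "y \<in> K" if y: "y \<in> carrier R" "x \<otimes> y \<in> K" for y
  proof (rule ccontr)
    assume "y \<notin> K"
    then obtain p where "p \<in> maximal_colons K" "colon K y \<subseteq> p"
      using colon_subset_maximal_colon[OF K y(1)] by blast
    then show False using x y by (auto simp: colon_def)
  qed
  then show "regular_mod K x" using x by (simp add: regular_mod_def)
qed

lemma exists_regular_mod_two:
  assumes A: "ideal A R" and K: "ideal K R" and L: "ideal L R"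
    and no_K: "\<And>p. p \<in> assoc_primes K \<Longrightarrow> \<not> A \<subseteq> p"
    and no_L: "\<And>p. p \<in> assoc_primes L \<Longrightarrow> \<not> A \<subseteq> p"
  obtains z where "z \<in> A" "regular_mod K z" "regular_mod L z"
proof -
  let ?S = "maximal_colons K \<union> maximal_colons L"
  have S: "p \<in> assoc_primes K \<union> assoc_primes L" if "p \<in> ?S" for p
    using that maximal_colons_assoc[OF K] maximal_colons_assoc[OF L] by blast
  obtain z where "z \<in> A" "z \<notin> \<Union>?S"
  proof (rule prime_avoidance[OF A, of ?S])
    show "finite ?S" using finite_maximal_colons K L by simp
    fix p assume "p \<in> ?S"
    then show "primeideal p R" "\<not> A \<subseteq> p" using S no_K no_L assoc_prime_ideal by blast+
  qed
  then show ?thesis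
    using that[of z] regular_mod_iff_maximal_colons K L ideal_mem_carrier[OF A] by simp
qed

lemma exists_regular_mod:
  assumes "ideal A R" "ideal K R" "\<And>p. p \<in> assoc_primes K \<Longrightarrow> \<not> A \<subseteq> p"
  obtains z where "z \<in> A" "regular_mod K z"
  using exists_regular_mod_two[of A K K] assms by blast

end

section \<open>Regular sequences over a Noetherian local ring\<close>

context cring
begin

text \<open>The ideal is an argument because inductions pass from \<open>K\<close> to \<open>K + (x)\<close>.\<close>

primrec regular_seq_mod :: "'a set \<Rightarrow> 'a list \<Rightarrow> bool"
  where
    "regular_seq_mod K [] \<longleftrightarrow> True"
  | "regular_seq_mod K (x # xs) \<longleftrightarrow> regular_mod K x \<and> regular_seq_mod (adjoin K x) xs"

end

locale noetherian_local = noetherian_cring +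
  fixes m
  assumes maximal: "maximalideal m R" and unique: "\<And>n. maximalideal n R \<Longrightarrow> n = m"
begin

lemma m_ideal: "ideal m R"
  using maximal maximalideal.axioms(1) by blast

lemma m_prime: "primeideal m R"
  using maximal by (rule maximalideal_prime)

lemma proper_ideal_subset_m:
  assumes A: "ideal A R" "\<one> \<notin> A"
  shows "A \<subseteq> m"
proof -
  let ?S = "{B. ideal B R \<and> A \<subseteq> B \<and> \<one> \<notin> B}"
  obtain M where M: "M \<in> ?S" "\<And>N. N \<in> ?S \<Longrightarrow> M \<subseteq> N \<Longrightarrow> N = M"
    using maximal_ideal_in_family[of ?S] A by blast
  have "maximalideal M R"
  proof (rule maximalidealI)
    show "ideal M R" "carrier R \<noteq> M" using M(1) by auto
    fix J assume J: "ideal J R" "M \<subseteq> J" "J \<subseteq> carrier R"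
    show "J = M \<or> J = carrier R"
    proof (cases "\<one> \<in> J")
      case True
      then show ?thesis using ideal_eq_carrier_iff[OF J(1)] by simp
    next
      case False
      then have "J \<in> ?S" using J M(1) by blast
      then show ?thesis using M(2) J(2) by blast
    qed
  qed
  then show ?thesis using unique M(1) by blast
qed

lemma prime_subset_m: "primeideal p R \<Longrightarrow> p \<subseteq> m"
  using proper_ideal_subset_m primeideal.axioms(1) prime_not_one by blast

text \<open>Nakayama's lemma for a cyclic module: \<open>1 - r\<close> lies outside \<open>m\<close>, so it generates the unit
  ideal.\<close>

lemma mem_of_minus_mult_mem:
  assumes K: "ideal K R" and r: "r \<in> m" and v: "v \<in> carrier R" and mem: "v \<ominus> r \<otimes> v \<in> K"
  shows "v \<in> K"
proof (rule ccontr)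
  assume "v \<notin> K"
  have rc: "r \<in> carrier R" using r ideal_mem_carrier[OF m_ideal] by blast
  have "\<one> \<notin> colon K v" using \<open>v \<notin> K\<close> v by (simp add: colon_def)
  then have "colon K v \<subseteq> m" using proper_ideal_subset_m colon_ideal[OF K v] by blast
  moreover have "(\<one> \<ominus> r) \<otimes> v = v \<ominus> r \<otimes> v" using rc v by algebra
  then have "\<one> \<ominus> r \<in> colon K v" using mem rc by (simp add: colon_def)
  ultimately have "(\<one> \<ominus> r) \<oplus> r \<in> m" using r by (intro ideal_add[OF m_ideal]) auto
  moreover have "(\<one> \<ominus> r) \<oplus> r = \<one>" using rc by algebra
  ultimately show False using prime_not_one[OF m_prime] by simp
qed

text \<open>Whether \<open>m\<close> consists of zero divisors after one step does not depend on the regular element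
  chosen for that step: since \<open>x\<close> kills \<open>u\<close>, \<open>x u = a v\<close> modulo \<open>K\<close>, and cancelling
  \<open>x\<close> or \<open>a\<close> transports the two properties of \<open>u\<close> modulo \<open>K + (a)\<close> to \<open>v\<close> modulo \<open>K + (x)\<close>.\<close>

lemma m_assoc_adjoin_transfer:
  assumes K: "ideal K R" and x: "regular_mod K x" "x \<in> m" and a: "regular_mod K a"
    and u: "u \<in> carrier R" "u \<notin> adjoin K a" "m \<subseteq> colon (adjoin K a) u"
  shows "\<exists>v\<in>carrier R - adjoin K x. m \<subseteq> colon (adjoin K x) v"
proof -
  have c: "x \<in> carrier R" "a \<in> carrier R" using x a by (auto simp: regular_mod_def)
  have "x \<otimes> u \<in> adjoin K a" using u(3) x(2) by (auto simp: colon_def)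
  then obtain v where v: "v \<in> carrier R" "x \<otimes> u \<ominus> v \<otimes> a \<in> K"
    by (auto simp: adjoin_iff[OF K c(2)])
  have "v \<notin> adjoin K x"
  proof
    assume "v \<in> adjoin K x"
    then obtain w where w: "w \<in> carrier R" "v \<ominus> w \<otimes> x \<in> K" by (auto simp: adjoin_iff[OF K c(1)])
    have "x \<otimes> (u \<ominus> w \<otimes> a) = (x \<otimes> u \<ominus> v \<otimes> a) \<oplus> a \<otimes> (v \<ominus> w \<otimes> x)"
      using c u(1) v(1) w(1) by algebra
    then have "x \<otimes> (u \<ominus> w \<otimes> a) \<in> K"
      using ideal_add[OF K v(2) ideal_l_mult[OF K w(2) c(2)]] by simp
    then have "u \<ominus> w \<otimes> a \<in> K" using regular_modD[OF x(1)] u(1) w(1) c by simp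
    then show False using u(1,2) w(1) by (auto simp: adjoin_iff[OF K c(2)])
  qed
  moreover have "r \<in> colon (adjoin K x) v" if r: "r \<in> m" for r
  proof -
    have rc: "r \<in> carrier R" using r ideal_mem_carrier[OF m_ideal] by blast
    have "r \<otimes> u \<in> adjoin K a" using u(3) r by (auto simp: colon_def)
    then obtain w where w: "w \<in> carrier R" "r \<otimes> u \<ominus> w \<otimes> a \<in> K"
      by (auto simp: adjoin_iff[OF K c(2)])
    have "a \<otimes> (r \<otimes> v \<ominus> w \<otimes> x) = x \<otimes> (r \<otimes> u \<ominus> w \<otimes> a) \<ominus> r \<otimes> (x \<otimes> u \<ominus> v \<otimes> a)"
      using c u(1) v(1) w(1) rc by algebra
    then have "a \<otimes> (r \<otimes> v \<ominus> w \<otimes> x) \<in> K"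
      using ideal_minus[OF K ideal_l_mult[OF K w(2) c(1)] ideal_l_mult[OF K v(2) rc]] by simp
    then have "r \<otimes> v \<ominus> w \<otimes> x \<in> K" using regular_modD[OF a] rc v(1) w(1) c by simp
    then show ?thesis using rc v(1) w(1) by (auto simp: colon_def adjoin_iff[OF K c(1)])
  qed
  ultimately show ?thesis using v(1) by blast
qed

text \<open>Any regular element can start a regular sequence of the same length as a given one.  A
  sequence \<open>x, x', \<dots>\<close> is connected with \<open>a\<close> through an element \<open>z\<close> that is regular modulo both
  \<open>K + (x)\<close> and \<open>K + (a)\<close>.  The induction hypothesis, applied modulo \<open>K + (x)\<close>, changes the sequence
  into \<open>x, z, \<dots>\<close>; interchanging gives \<open>z, x, \<dots>\<close>; the induction hypothesis modulo \<open>K + (z)\<close> gives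
  \<open>z, a, \<dots>\<close>; interchanging again gives \<open>a, z, \<dots>\<close>.  Such a \<open>z\<close> exists because \<open>m\<close> is an associated
  prime of neither ideal: not of \<open>K + (x)\<close> because of \<open>x'\<close>, hence not of \<open>K + (a)\<close> by
  \<open>m_assoc_adjoin_transfer\<close>.\<close>

lemma regular_seq_exchange:
  assumes "ideal K R" "set xs \<subseteq> m" "length xs = Suc n" "regular_seq_mod K xs"
    and "a \<in> m" "regular_mod K a"
  shows "\<exists>ys. set ys \<subseteq> m \<and> length ys = n \<and> regular_seq_mod (adjoin K a) ys"
  using assms
proof (induction n arbitrary: K xs a)
  case 0
  then show ?case by auto
next
  case (Suc n)
  note K = \<open>ideal K R\<close> and a = \<open>a \<in> m\<close> \<open>regular_mod K a\<close>
  obtain x x' xs' where xs: "xs = x # x' # xs'" using Suc.prems(3) by (auto simp: length_Suc_conv)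
  have x: "regular_mod K x" "x \<in> m" and x': "regular_mod (adjoin K x) x'" "x' \<in> m"
    using Suc.prems xs by auto
  have c: "x \<in> carrier R" "a \<in> carrier R" using x a by (auto simp: regular_mod_def)
  have Kx: "ideal (adjoin K x) R" and Ka: "ideal (adjoin K a) R" using K c by (auto intro: adjoin_ideal)
  have no_colon: "\<not> m \<subseteq> colon (adjoin K x) v" if "v \<in> carrier R - adjoin K x" for v
    using that x' regular_modD[OF x'(1), of v] by (auto simp: colon_def)
  have proper: "y \<notin> L" if "primeideal p R" "ideal L R" "p = colon L y" "y \<in> carrier R" for p L y
    using that colon_eq_carrier_iff[of L y] prime_not_one[of p] by auto
  obtain z where z: "z \<in> m" "regular_mod (adjoin K x) z" "regular_mod (adjoin K a) z"
  proof (rule exists_regular_mod_two[OF m_ideal Kx Ka])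
    fix p assume "p \<in> assoc_primes (adjoin K x)"
    then show "\<not> m \<subseteq> p" using no_colon proper[of p] Kx by (auto simp: assoc_primes_def)
  next
    fix p assume "p \<in> assoc_primes (adjoin K a)"
    then obtain u where u: "u \<in> carrier R - adjoin K a" "p = colon (adjoin K a) u"
      using proper[of p] Ka by (auto simp: assoc_primes_def)
    then show "\<not> m \<subseteq> p" using m_assoc_adjoin_transfer[OF K x a(2), of u] no_colon by blast
  qed
  have zc: "z \<in> carrier R" using z(2) by (simp add: regular_mod_def)
  have Kz: "ideal (adjoin K z) R" using K zc by (rule adjoin_ideal)
  obtain ys where ys: "set ys \<subseteq> m" "length ys = n" "regular_seq_mod (adjoin (adjoin K x) z) ys"
    using Suc.IH[OF Kx, of "x' # xs'" z] Suc.prems z xs by auto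
  have "regular_seq_mod (adjoin K z) (x # ys)"
    using ys regular_mod_swap[OF K x(1) z(2)] adjoin_commute[OF K c(1) zc] by simp
  moreover have "regular_mod (adjoin K z) a" using regular_mod_swap[OF K a(2) z(3)] .
  ultimately obtain zs where zs: "set zs \<subseteq> m" "length zs = n" "regular_seq_mod (adjoin (adjoin K z) a) zs"
    using Suc.IH[OF Kz, of "x # ys" a] ys x(2) a(1) by auto
  then have "regular_seq_mod (adjoin K a) (z # zs)"
    using z(3) adjoin_commute[OF K c(2) zc] by simp
  then show ?case using zs z(1) by (intro exI[of _ "z # zs"]) auto
qed

text \<open>Repeated exchange compares two regular sequences entry by entry.\<close>

lemma regular_seq_continue:
  assumes "ideal K R" "set xs \<subseteq> m" "regular_seq_mod K xs" "set as \<subseteq> m" "regular_seq_mod K as"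
    "length xs = length as + n"
  shows "\<exists>ys. set ys \<subseteq> m \<and> length ys = n \<and> regular_seq_mod K (as @ ys)"
  using assms
proof (induction as arbitrary: K xs)
  case Nil
  then show ?case by auto
next
  case (Cons a as)
  have a: "a \<in> m" "regular_mod K a" "a \<in> carrier R" using Cons.prems by (auto simp: regular_mod_def)
  then obtain zs where "set zs \<subseteq> m" "length zs = length as + n" "regular_seq_mod (adjoin K a) zs"
    using regular_seq_exchange[of K xs "length as + n" a] Cons.prems by auto
  then show ?case using Cons.IH[of "adjoin K a" zs] Cons.prems adjoin_ideal a by auto
qed

text \<open>A regular sequence that cannot be prolonged exists because the ideals generated by its initial
  segments ascend.\<close>

lemma exists_maximal_regular_seq:
  assumes K: "ideal K R" "K \<subseteq> m"
  shows "\<exists>as. set as \<subseteq> m \<and> regular_seq_mod K as \<and> \<not> (\<exists>x\<in>m. regular_seq_mod K (as @ [x]))"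
proof (rule ccontr)
  assume none: "\<not> ?thesis"
  define gen where "gen = foldl adjoin K"
  have gen: "ideal (gen as) R \<and> gen as \<subseteq> m" if "set as \<subseteq> m" for as
    using that
  proof (induction as rule: rev_induct)
    case (snoc x as)
    then show ?case
      using adjoin_ideal[of "gen as" x] ideal_mem_carrier[OF m_ideal] adjoin_minimal[of "gen as" x m] m_ideal
      by (auto simp: gen_def)
  qed (use K in \<open>simp add: gen_def\<close>)
  have snoc_iff: "regular_seq_mod L (as @ [x]) \<longleftrightarrow> regular_seq_mod L as \<and> regular_mod (foldl adjoin L as) x"
    for L as x by (induction as arbitrary: L) auto
  let ?S = "{gen as |as. set as \<subseteq> m \<and> regular_seq_mod K as}"
  have "gen [] \<in> ?S" by force
  then obtain M where M: "M \<in> ?S" "\<And>N. N \<in> ?S \<Longrightarrow> M \<subseteq> N \<Longrightarrow> N = M"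
    using maximal_ideal_in_family[of ?S] gen by blast
  then obtain as where as: "M = gen as" "set as \<subseteq> m" "regular_seq_mod K as" by blast
  then obtain x where x: "x \<in> m" "regular_seq_mod K (as @ [x])" using none by blast
  have xc: "x \<in> carrier R" using x(1) ideal_mem_carrier[OF m_ideal] by blast
  have ideal: "ideal (gen as) R" using gen as(2) by blast
  have gx: "gen (as @ [x]) = adjoin (gen as) x" by (simp add: gen_def)
  have "set (as @ [x]) \<subseteq> m" using as x by simp
  then have "gen (as @ [x]) = gen as"
    using M(2)[of "gen (as @ [x])"] as x subset_adjoin[OF ideal xc] gx by blast
  then have "x \<in> gen as" using mem_adjoin[OF ideal xc] gx by simp
  then have "\<one> \<in> gen as"
    using x(2) xc snoc_iff regular_modD[of "gen as" x \<one>] by (simp add: gen_def)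
  then show False using gen[OF as(2)] prime_not_one[OF m_prime] by blast
qed

text \<open>A longer regular sequence could be exchanged into a prolongation of a maximal one.\<close>

lemma regular_seq_length_bounded:
  assumes K: "ideal K R" "K \<subseteq> m"
  obtains N where "\<And>xs. set xs \<subseteq> m \<Longrightarrow> regular_seq_mod K xs \<Longrightarrow> length xs \<le> N"
proof -
  obtain as where as: "set as \<subseteq> m" "regular_seq_mod K as" "\<not> (\<exists>x\<in>m. regular_seq_mod K (as @ [x]))"
    using exists_maximal_regular_seq[OF K] by blast
  have prefix: "regular_seq_mod L us" if "regular_seq_mod L (us @ vs)" for L us vs
    using that by (induction us arbitrary: L) auto
  have "length xs \<le> length as" if xs: "set xs \<subseteq> m" "regular_seq_mod K xs" for xs
  proof (rule ccontr)
    assume "\<not> length xs \<le> length as"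
    then obtain n where "length xs = length as + Suc n"
      using less_imp_Suc_add[of "length as" "length xs"] by auto
    then obtain ys where ys: "set ys \<subseteq> m" "length ys = Suc n" "regular_seq_mod K (as @ ys)"
      using regular_seq_continue[OF K(1) xs as(1,2)] by blast
    then obtain y zs where y: "ys = y # zs" by (cases ys) auto
    then have "regular_seq_mod K (as @ [y])" using ys(3) prefix[of K "as @ [y]" zs] by simp
    then show False using as(3) ys(1) y by auto
  qed
  then show ?thesis using that by blast
qed

text \<open>Let \<open>N\<close> be the set of elements outside \<open>K\<close> that \<open>p\<close> annihilates modulo \<open>K\<close>.  It is enough
  to find \<open>u\<close> in \<open>N\<close> outside \<open>K + (x)\<close>, for then \<open>p\<close> and \<open>x\<close> kill \<open>u\<close> modulo \<open>K + (x)\<close>, while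
  \<open>x\<close> is not in \<open>p\<close>.  Take \<open>u\<close> with \<open>K + (u)\<close> maximal: if \<open>u = x v\<close> modulo \<open>K\<close>, then \<open>v\<close> is again
  in \<open>N\<close>, so maximality makes \<open>v\<close> a multiple of \<open>u = x v\<close>, and \<open>v\<close> vanishes modulo \<open>K\<close>.\<close>

lemma assoc_prime_step:
  assumes K: "ideal K R" and p: "p \<in> assoc_primes K" and x: "x \<in> m" "regular_mod K x"
  obtains q where "q \<in> assoc_primes (adjoin K x)" "p \<subset> q"
proof -
  have xc: "x \<in> carrier R" using x by (simp add: regular_mod_def)
  have Kx: "ideal (adjoin K x) R" using K xc by (rule adjoin_ideal)
  have pp: "primeideal p R" "ideal p R" using p assoc_prime_ideal primeideal.axioms(1) by blast+
  obtain y where y: "y \<in> carrier R" "p = colon K y" using p by (auto simp: assoc_primes_def)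
  have "y \<notin> K" using y colon_eq_carrier_iff[OF K y(1)] prime_not_one[OF pp(1)] by auto
  define N where "N = {u \<in> carrier R - K. \<forall>r\<in>p. r \<otimes> u \<in> K}"
  have "y \<in> N" using y \<open>y \<notin> K\<close> by (auto simp: N_def colon_def)
  let ?S = "adjoin K ` N"
  have "?S \<noteq> {}" using \<open>y \<in> N\<close> by blast
  moreover have "\<And>L. L \<in> ?S \<Longrightarrow> ideal L R" using adjoin_ideal[OF K] by (auto simp: N_def)
  ultimately obtain M where M: "M \<in> ?S" "\<And>L. L \<in> ?S \<Longrightarrow> M \<subseteq> L \<Longrightarrow> L = M"
    using maximal_ideal_in_family[of ?S] by metis
  then obtain u where u: "M = adjoin K u" "u \<in> N" by blast
  have uc: "u \<in> carrier R" "u \<notin> K" using u(2) by (auto simp: N_def)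
  have "u \<notin> adjoin K x"
  proof
    assume "u \<in> adjoin K x"
    then obtain v where v: "v \<in> carrier R" "u \<ominus> v \<otimes> x \<in> K" by (auto simp: adjoin_iff[OF K xc])
    have "r \<otimes> v \<in> K" if r: "r \<in> p" for r
    proof -
      have rc: "r \<in> carrier R" using r ideal_mem_carrier[OF pp(2)] by blast
      have ru: "r \<otimes> u \<in> K" using u(2) r by (auto simp: N_def)
      have "x \<otimes> (r \<otimes> v) = r \<otimes> u \<ominus> r \<otimes> (u \<ominus> v \<otimes> x)" using rc uc v(1) xc by algebra
      then have "x \<otimes> (r \<otimes> v) \<in> K"
        using ideal_minus[OF K ru ideal_l_mult[OF K v(2) rc]] by simp
      then show ?thesis using regular_modD[OF x(2)] rc v(1) by simp
    qed
    moreover have "v \<notin> K"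
    proof
      assume "v \<in> K"
      then have "(u \<ominus> v \<otimes> x) \<oplus> v \<otimes> x \<in> K"
        using v xc by (intro ideal_add[OF K] ideal_r_mult[OF K])
      moreover have "(u \<ominus> v \<otimes> x) \<oplus> v \<otimes> x = u" using uc v(1) xc by algebra
      ultimately show False using uc by simp
    qed
    ultimately have vN: "v \<in> N" using v(1) by (simp add: N_def)
    have Kv: "ideal (adjoin K v) R" using K v(1) by (rule adjoin_ideal)
    have "u \<ominus> x \<otimes> v = u \<ominus> v \<otimes> x" using uc v(1) xc by algebra
    then have "u \<in> adjoin K v"
      unfolding adjoin_iff[OF K v(1)] using v uc xc by (intro conjI bexI[of _ x]) auto
    then have "M \<subseteq> adjoin K v"
      unfolding u(1) using adjoin_minimal[OF K uc(1) Kv subset_adjoin[OF K v(1)]] by blast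
    then have "adjoin K v = M" using M(2) vN by blast
    then have "v \<in> adjoin K u" using mem_adjoin[OF K v(1)] u(1) by simp
    then obtain r where r: "r \<in> carrier R" "v \<ominus> r \<otimes> u \<in> K" by (auto simp: adjoin_iff[OF K uc(1)])
    have "v \<ominus> r \<otimes> x \<otimes> v = (v \<ominus> r \<otimes> u) \<oplus> r \<otimes> (u \<ominus> v \<otimes> x)" using uc v(1) xc r(1) by algebra
    then have "v \<ominus> r \<otimes> x \<otimes> v \<in> K" using ideal_add[OF K r(2) ideal_l_mult[OF K v(2) r(1)]] by simp
    then have "v \<in> K" using mem_of_minus_mult_mem[OF K _ v(1)] ideal_l_mult[OF m_ideal x(1) r(1)] by blast
    then show False using \<open>v \<notin> K\<close> by simp
  qed
  then obtain q where q: "q \<in> assoc_primes (adjoin K x)" "colon (adjoin K x) u \<subseteq> q"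
    using colon_subset_assoc_prime[OF Kx uc(1)] by blast
  have "p \<subseteq> colon (adjoin K x) u"
    using u(2) ideal_mem_carrier[OF pp(2)] subset_adjoin[OF K xc] by (auto simp: N_def colon_def)
  moreover have "x \<in> colon (adjoin K x) u"
    using ideal_r_mult[OF Kx mem_adjoin[OF K xc] uc(1)] xc by (simp add: colon_def)
  moreover have "x \<notin> p" using y \<open>y \<notin> K\<close> regular_modD[OF x(2) y(1)] by (auto simp: colon_def)
  ultimately have "p \<subset> q" using q(2) by blast
  then show ?thesis using that q(1) by blast
qed

lemma prime_chain_Cons:
  assumes "primeideal p R" "prime_chain R f n" "p \<subset> f 0"
  shows "prime_chain R (case_nat p f) (Suc n)"
  using assms by (auto simp: prime_chain_def less_Suc_eq_0_disj split: nat.split)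

text \<open>The inequality between the depth of \<open>R\<close> modulo \<open>K\<close> and the dimension of \<open>R\<close> modulo an
  associated prime of \<open>K\<close>.\<close>

lemma prime_chain_above_assoc_prime:
  assumes "ideal K R" "p \<in> assoc_primes K" "set xs \<subseteq> m" "regular_seq_mod K xs"
  shows "\<exists>f. prime_chain R f (length xs) \<and> f 0 = p"
  using assms
proof (induction xs arbitrary: K p)
  case Nil
  then show ?case using assoc_prime_ideal by (auto simp: prime_chain_def intro!: exI[of _ "\<lambda>_. p"])
next
  case (Cons x xs)
  have x: "x \<in> m" "regular_mod K x" "x \<in> carrier R" using Cons.prems by (auto simp: regular_mod_def)
  obtain q where q: "q \<in> assoc_primes (adjoin K x)" "p \<subset> q"
    using assoc_prime_step[OF Cons.prems(1,2) x(1,2)] by blast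
  then obtain f where f: "prime_chain R f (length xs)" "f 0 = q"
    using Cons.IH[of "adjoin K x" q] Cons.prems adjoin_ideal x(3) by auto
  then have "prime_chain R (case_nat p f) (length (x # xs))"
    using prime_chain_Cons assoc_prime_ideal[OF Cons.prems(2)] q(2) by simp
  then show ?case by (intro exI[of _ "case_nat p f"]) simp
qed

end

section \<open>Connectedness in codimension one\<close>

context cring
begin

lemma ideal_prod_mult_mem:
  assumes K: "ideal K R" and I: "ideal I R" "ideal I' R" and J: "ideal J R" "ideal J' R"
    and mem: "\<And>i j i' j'. i \<in> I \<Longrightarrow> j \<in> J \<Longrightarrow> i' \<in> I' \<Longrightarrow> j' \<in> J' \<Longrightarrow> (i \<otimes> j) \<otimes> (i' \<otimes> j') \<in> K"
    and ab: "a \<in> I \<cdot> I'" "b \<in> J \<cdot> J'"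
  shows "a \<otimes> b \<in> K"
proof -
  note sub = ideal_mem_carrier[OF I(1)] ideal_mem_carrier[OF I(2)]
    ideal_mem_carrier[OF J(1)] ideal_mem_carrier[OF J(2)]
  have prod_carrier: "I \<cdot> I' \<subseteq> carrier R" "J \<cdot> J' \<subseteq> carrier R"
    using ideal_prod_in_carrier I J by blast+
  have *: "(i \<otimes> i') \<otimes> b \<in> K" if i: "i \<in> I" "i' \<in> I'" for i i'
    using ab(2)
  proof (induction rule: ideal_prod.induct)
    case (prod j j')
    have "(i \<otimes> i') \<otimes> (j \<otimes> j') = (i \<otimes> j) \<otimes> (i' \<otimes> j')"
      using sub(1)[OF i(1)] sub(2)[OF i(2)] sub(3)[OF prod(1)] sub(4)[OF prod(2)] by algebra
    then show ?case using mem[OF i(1) prod(1) i(2) prod(2)] by simp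
  next
    case (sum s t)
    then have "s \<in> carrier R" "t \<in> carrier R" using prod_carrier by auto
    then show ?case using sum sub i by (simp add: r_distr ideal_add[OF K])
  qed
  show ?thesis using ab(1)
  proof (induction rule: ideal_prod.induct)
    case (prod i i')
    then show ?case by (rule *)
  next
    case (sum s t)
    then have "s \<in> carrier R" "t \<in> carrier R" using prod_carrier by auto
    then show ?case using sum prod_carrier(2) ab(2) by (simp add: l_distr ideal_add[OF K] subset_iff)
  qed
qed

text \<open>The algebraic core of the connectedness argument.  With \<open>s a = a1 + a2\<close> and \<open>s b = b1 + b2\<close> the
  mixed products vanish, so \<open>b (s a1) = a1 b1 = a (s b1)\<close> and \<open>s a1 = c a\<close>; similarly
  \<open>s a2 = d a\<close>.  For \<open>s = 1\<close> this says that \<open>1\<close> decomposes into an element killing \<open>J\<close> and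
  one killing \<open>I\<close>; the factor \<open>s\<close> plays the part of a denominator.\<close>

lemma square_split_of_regular_pair:
  assumes I: "ideal I R" and J: "ideal J R" and IJ: "\<And>x y. x \<in> I \<Longrightarrow> y \<in> J \<Longrightarrow> x \<otimes> y = \<zero>"
    and a: "regular_mod {\<zero>} a" and b: "regular_mod (PIdl a) b"
    and s: "s \<in> carrier R" and sa: "s \<otimes> a \<in> I <+> J" and sb: "s \<otimes> b \<in> I <+> J"
  obtains c d where "c \<in> carrier R" "d \<in> carrier R" "s \<otimes> s = c \<oplus> d"
    "\<And>y. y \<in> J \<Longrightarrow> c \<otimes> y = \<zero>" "\<And>x. x \<in> I \<Longrightarrow> d \<otimes> x = \<zero>"
proof -
  have ab: "a \<in> carrier R" "b \<in> carrier R" using a b by (auto simp: regular_mod_def)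
  have cancel: "y = \<zero>" if "y \<in> carrier R" "a \<otimes> y = \<zero>" for y
    using regular_modD[OF a] that by simp
  obtain a1 a2 where a12: "a1 \<in> I" "a2 \<in> J" "s \<otimes> a = a1 \<oplus> a2"
    using sa by (auto simp: set_add_def')
  obtain b1 b2 where b12: "b1 \<in> I" "b2 \<in> J" "s \<otimes> b = b1 \<oplus> b2"
    using sb by (auto simp: set_add_def')
  have car: "a1 \<in> carrier R" "a2 \<in> carrier R" "b1 \<in> carrier R" "b2 \<in> carrier R"
    using a12 b12 ideal_mem_carrier[OF I] ideal_mem_carrier[OF J] by auto
  have zero: "a1 \<otimes> b2 = \<zero>" "b1 \<otimes> a2 = \<zero>" using IJ a12 b12 by auto
  have "b \<otimes> (s \<otimes> a1) = (s \<otimes> b) \<otimes> a1" using s ab car by algebra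
  also have "\<dots> = a1 \<otimes> b1 \<oplus> a1 \<otimes> b2" unfolding b12(3) using car by algebra
  also have "\<dots> = a1 \<otimes> b1 \<oplus> b1 \<otimes> a2" using zero by simp
  also have "\<dots> = (s \<otimes> a) \<otimes> b1" unfolding a12(3) using car by algebra
  also have "\<dots> = (s \<otimes> b1) \<otimes> a" using s ab car by algebra
  finally have "b \<otimes> (s \<otimes> a1) \<in> PIdl a" using s car by (auto simp: PIdl_iff)
  then have "s \<otimes> a1 \<in> PIdl a" using regular_modD[OF b] s car by simp
  then obtain c where c: "c \<in> carrier R" "s \<otimes> a1 = c \<otimes> a" by (auto simp: PIdl_iff)
  have "b \<otimes> (s \<otimes> a2) = (s \<otimes> b) \<otimes> a2" using s ab car by algebra
  also have "\<dots> = b1 \<otimes> a2 \<oplus> a2 \<otimes> b2" unfolding b12(3) using car by algebra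
  also have "\<dots> = a1 \<otimes> b2 \<oplus> a2 \<otimes> b2" using zero by simp
  also have "\<dots> = (s \<otimes> a) \<otimes> b2" unfolding a12(3) using car by algebra
  also have "\<dots> = (s \<otimes> b2) \<otimes> a" using s ab car by algebra
  finally have "b \<otimes> (s \<otimes> a2) \<in> PIdl a" using s car by (auto simp: PIdl_iff)
  then have "s \<otimes> a2 \<in> PIdl a" using regular_modD[OF b] s car by simp
  then obtain d where d: "d \<in> carrier R" "s \<otimes> a2 = d \<otimes> a" by (auto simp: PIdl_iff)
  have "a \<otimes> (s \<otimes> s \<ominus> (c \<oplus> d)) = s \<otimes> (s \<otimes> a) \<ominus> (c \<otimes> a \<oplus> d \<otimes> a)"
    using s ab c(1) d(1) by algebra
  also have "\<dots> = s \<otimes> (a1 \<oplus> a2) \<ominus> (s \<otimes> a1 \<oplus> s \<otimes> a2)" using a12(3) c(2) d(2) by simp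
  also have "\<dots> = \<zero>" using s car by algebra
  finally have "s \<otimes> s \<ominus> (c \<oplus> d) = \<zero>" using cancel s c(1) d(1) by simp
  then have "s \<otimes> s = c \<oplus> d" using s c(1) d(1) by simp
  moreover have "c \<otimes> y = \<zero>" if y: "y \<in> J" for y
  proof (rule cancel)
    have yc: "y \<in> carrier R" using y ideal_mem_carrier[OF J] by blast
    then show "c \<otimes> y \<in> carrier R" using c(1) by simp
    have "a \<otimes> (c \<otimes> y) = (c \<otimes> a) \<otimes> y" using ab c(1) yc by algebra
    also have "\<dots> = s \<otimes> (a1 \<otimes> y)" unfolding c(2)[symmetric] using s car yc by algebra
    finally show "a \<otimes> (c \<otimes> y) = \<zero>" using IJ[OF a12(1) y] s by simp
  qed
  moreover have "d \<otimes> x = \<zero>" if x: "x \<in> I" for x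
  proof (rule cancel)
    have xc: "x \<in> carrier R" using x ideal_mem_carrier[OF I] by blast
    then show "d \<otimes> x \<in> carrier R" using d(1) by simp
    have "a \<otimes> (d \<otimes> x) = (d \<otimes> a) \<otimes> x" using ab d(1) xc by algebra
    also have "\<dots> = s \<otimes> (x \<otimes> a2)" unfolding d(2)[symmetric] using s car xc by algebra
    finally show "a \<otimes> (d \<otimes> x) = \<zero>" using IJ[OF x a12(2)] s by simp
  qed
  ultimately show ?thesis using that c(1) d(1) by blast
qed

end

context noetherian_cring
begin

text \<open>An annihilator that is maximal among those contained in \<open>P\<close> is prime: when \<open>a b\<close> kills \<open>w\<close>,
  either the annihilator of \<open>b w\<close> still lies in \<open>P\<close> and equals that of \<open>w\<close>, or some \<open>t\<close> outside
  \<open>P\<close> kills \<open>b w\<close>, and then \<open>b\<close> kills \<open>t w\<close>, whose annihilator is that of \<open>w\<close>.\<close>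

lemma prime_contains_assoc_prime:
  assumes K: "ideal K R" and P: "primeideal P R" "K \<subseteq> P"
  obtains q where "q \<in> assoc_primes K" "q \<subseteq> P"
proof -
  define N where "N = {w \<in> carrier R. colon K w \<subseteq> P}"
  have "\<one> \<in> N" using P(2) by (auto simp: N_def colon_def)
  then have "colon K ` N \<noteq> {}" by blast
  moreover have "\<And>L. L \<in> colon K ` N \<Longrightarrow> ideal L R" using colon_ideal[OF K] by (auto simp: N_def)
  ultimately obtain M where M: "M \<in> colon K ` N" "\<And>L. L \<in> colon K ` N \<Longrightarrow> M \<subseteq> L \<Longrightarrow> L = M"
    using maximal_ideal_in_family[of "colon K ` N"] by metis
  then obtain w where w: "w \<in> carrier R" "colon K w \<subseteq> P" "M = colon K w" by (auto simp: N_def)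
  have stable: "colon K (t \<otimes> w) = colon K w" if t: "t \<in> carrier R" "colon K (t \<otimes> w) \<subseteq> P" for t
  proof -
    have "colon K w \<subseteq> colon K (t \<otimes> w)"
      using t w(1) by (auto simp: colon_def m_lcomm[of _ t] ideal_l_mult[OF K])
    then show ?thesis using M(2) w t by (auto simp: N_def)
  qed
  have "primeideal (colon K w) R"
  proof (rule primeidealI)
    show "ideal (colon K w) R" using colon_ideal[OF K w(1)] .
    show "cring R" by (rule cring_axioms)
    show "carrier R \<noteq> colon K w" using w(2) prime_not_one[OF P(1)] by auto
    fix a b assume ab: "a \<in> carrier R" "b \<in> carrier R" "a \<otimes> b \<in> colon K w"
    show "a \<in> colon K w \<or> b \<in> colon K w"
    proof (cases "colon K (b \<otimes> w) \<subseteq> P")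
      case True
      have "a \<in> colon K (b \<otimes> w)" using ab w(1) by (simp add: colon_def m_assoc)
      then show ?thesis using stable[OF ab(2) True] by simp
    next
      case False
      then obtain t where t: "t \<in> carrier R" "t \<otimes> (b \<otimes> w) \<in> K" "t \<notin> P" by (auto simp: colon_def)
      then have "b \<in> colon K (t \<otimes> w)" using ab(2) w(1) by (simp add: colon_def m_lcomm)
      moreover have "colon K (t \<otimes> w) \<subseteq> P"
      proof
        fix r assume r: "r \<in> colon K (t \<otimes> w)"
        then have "r \<otimes> t \<in> colon K w" using t w(1) by (simp add: colon_def m_assoc)
        then show "r \<in> P" using w(2) t r prime_mult_mem[OF P(1), of r t] by (auto simp: colon_def)
      qed
      ultimately show ?thesis using stable[OF t(1)] by simp
    qed
  qed
  then have "colon K w \<in> assoc_primes K" using w(1) by (auto simp: assoc_primes_def)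
  then show ?thesis using that w(2) by blast
qed

lemma subset_ideal_sum:
  assumes I: "ideal I R" and J: "ideal J R"
  shows "I \<subseteq> I <+>\<^bsub>R\<^esub> J" "J \<subseteq> I <+>\<^bsub>R\<^esub> J"
proof -
  have "x \<oplus> \<zero> \<in> I <+>\<^bsub>R\<^esub> J" if "x \<in> I" for x
    using that ideal_zero[OF J] unfolding set_add_def' by blast
  then show "I \<subseteq> I <+>\<^bsub>R\<^esub> J" using ideal_mem_carrier[OF I] by force
  have "\<zero> \<oplus> x \<in> I <+>\<^bsub>R\<^esub> J" if "x \<in> J" for x
    using that ideal_zero[OF I] unfolding set_add_def' by blast
  then show "J \<subseteq> I <+>\<^bsub>R\<^esub> J" using ideal_mem_carrier[OF J] by force
qed

text \<open>With \<open>K = 0\<close>, the ideals \<open>I\<close> and \<open>J\<close> are to replace \<open>\<Inter>\<XX>\<close> and \<open>\<Inter>\<YY>\<close>, whose product is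
  in general only nilpotent.\<close>

definition complementary_mod :: "'a set set \<Rightarrow> 'a set set \<Rightarrow> 'a set \<Rightarrow> 'a set \<Rightarrow> 'a set \<Rightarrow> bool"
  where "complementary_mod \<XX> \<YY> K I J \<longleftrightarrow>
    ideal I R \<and> ideal J R \<and> (\<forall>a\<in>I. \<forall>b\<in>J. a \<otimes> b \<in> K) \<and>
    (\<forall>P. primeideal P R \<and> I \<subseteq> P \<longrightarrow> (\<exists>q\<in>\<XX>. q \<subseteq> P)) \<and>
    (\<forall>P. primeideal P R \<and> J \<subseteq> P \<longrightarrow> (\<exists>q\<in>\<YY>. q \<subseteq> P))"

lemma complementary_modD:
  assumes "complementary_mod \<XX> \<YY> K I J"
  shows "ideal I R" "ideal J R" "\<And>a b. a \<in> I \<Longrightarrow> b \<in> J \<Longrightarrow> a \<otimes> b \<in> K"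
    "\<And>P. primeideal P R \<Longrightarrow> I \<subseteq> P \<Longrightarrow> \<exists>q\<in>\<XX>. q \<subseteq> P"
    "\<And>P. primeideal P R \<Longrightarrow> J \<subseteq> P \<Longrightarrow> \<exists>q\<in>\<YY>. q \<subseteq> P"
  using assms unfolding complementary_mod_def by blast+

text \<open>Noetherian induction.  For prime \<open>K\<close> one of the two ideals is \<open>K\<close> and the other is \<open>R\<close>, which
  no prime contains.  If \<open>x y\<close> is in \<open>K\<close> but neither \<open>x\<close> nor \<open>y\<close> is, the ideals obtained for
  \<open>K + (x)\<close> and \<open>K + (y)\<close> are multiplied, since \<open>(K + (x)) (K + (y))\<close> lies in \<open>K\<close>.\<close>

lemma exists_complementary_ideals:
  assumes cover: "\<And>P. primeideal P R \<Longrightarrow> \<exists>q\<in>\<XX> \<union> \<YY>. q \<subseteq> P" and K: "ideal K R"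
  shows "\<exists>I J. complementary_mod \<XX> \<YY> K I J"
    (is "?split K")
proof (rule ccontr)
  assume "\<not> ?split K"
  then have "{K. ideal K R \<and> \<not> ?split K} \<noteq> {}" using K by blast
  then obtain L where L0: "L \<in> {K. ideal K R \<and> \<not> ?split K}"
    and max: "\<And>N. N \<in> {K. ideal K R \<and> \<not> ?split K} \<Longrightarrow> L \<subseteq> N \<Longrightarrow> N = L"
    by (rule maximal_ideal_in_family) auto
  have L: "ideal L R" "\<not> ?split L" using L0 by auto
  have above: "?split N" if "ideal N R" "L \<subset> N" for N using max[of N] that by blast
  have no_prime: "\<not> carrier R \<subseteq> P" if "primeideal P R" for P using prime_not_one[OF that] by auto
  have "\<not> primeideal L R"
  proof
    assume P: "primeideal L R"
    then consider q where "q \<in> \<XX>" "q \<subseteq> L" | q where "q \<in> \<YY>" "q \<subseteq> L" using cover by blast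
    then show False
    proof cases
      case 1
      have "complementary_mod \<XX> \<YY> L L (carrier R)"
        using 1 no_prime oneideal L(1) ideal_r_mult[OF L(1)] unfolding complementary_mod_def by blast
      then show False using L(2) by blast
    next
      case 2
      have "complementary_mod \<XX> \<YY> L (carrier R) L"
        using 2 no_prime oneideal L(1) ideal_l_mult[OF L(1)] unfolding complementary_mod_def by blast
      then show False using L(2) by blast
    qed
  qed
  moreover have "L \<noteq> carrier R"
  proof
    assume "L = carrier R"
    then have "complementary_mod \<XX> \<YY> L (carrier R) (carrier R)"
      using no_prime oneideal m_closed unfolding complementary_mod_def by blast
    then show False using L(2) by blast
  qed
  ultimately obtain x y where xy: "x \<in> carrier R" "y \<in> carrier R" "x \<otimes> y \<in> L" "x \<notin> L" "y \<notin> L"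
    using primeidealI[OF L(1) cring_axioms] by blast
  have Lx: "ideal (adjoin L x) R" "L \<subset> adjoin L x" and Ly: "ideal (adjoin L y) R" "L \<subset> adjoin L y"
    using xy(4,5) adjoin_ideal[OF L(1)] subset_adjoin[OF L(1)] mem_adjoin[OF L(1)] xy(1,2) by auto
  obtain I1 J1 where "complementary_mod \<XX> \<YY> (adjoin L x) I1 J1"
    using above[OF Lx] by blast
  note 1 = complementary_modD[OF this]
  obtain I2 J2 where "complementary_mod \<XX> \<YY> (adjoin L y) I2 J2"
    using above[OF Ly] by blast
  note 2 = complementary_modD[OF this]
  have mem: "u \<otimes> v \<in> L" if uv: "u \<in> adjoin L x" "v \<in> adjoin L y" for u v
  proof -
    obtain r where r: "u \<in> carrier R" "r \<in> carrier R" "u \<ominus> r \<otimes> x \<in> L"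
      using uv adjoin_iff[OF L(1) xy(1)] by blast
    obtain t where t: "v \<in> carrier R" "t \<in> carrier R" "v \<ominus> t \<otimes> y \<in> L"
      using uv adjoin_iff[OF L(1) xy(2)] by blast
    have expand: "u \<otimes> v = v \<otimes> (u \<ominus> w) \<oplus> (w \<otimes> (v \<ominus> z) \<oplus> w \<otimes> z)"
      if "w \<in> carrier R" "z \<in> carrier R" for w z
      using r(1) t(1) that by algebra
    have "(r \<otimes> x) \<otimes> (t \<otimes> y) = (r \<otimes> t) \<otimes> (x \<otimes> y)" using r(2) t(2) xy(1,2) by algebra
    then show ?thesis
      using expand[of "r \<otimes> x" "t \<otimes> y"] r t xy L(1) by (simp add: ideal_add ideal_l_mult)
  qed
  have "complementary_mod \<XX> \<YY> L (I1 \<cdot> I2) (J1 \<cdot> J2)"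
    unfolding complementary_mod_def
  proof (intro conjI ballI allI impI)
    show "ideal (I1 \<cdot> I2) R" "ideal (J1 \<cdot> J2) R" by (intro ideal_prod_is_ideal 1(1,2) 2(1,2))+
    fix a b assume "a \<in> I1 \<cdot> I2" "b \<in> J1 \<cdot> J2"
    then show "a \<otimes> b \<in> L"
      by (rule ideal_prod_mult_mem[OF L(1) 1(1) 2(1) 1(2) 2(2), rotated]) (intro mem 1(3) 2(3))
  next
    fix P assume P: "primeideal P R \<and> I1 \<cdot> I2 \<subseteq> P"
    then have "I1 \<subseteq> P \<or> I2 \<subseteq> P" using primeideal_divides_ideal_prod[OF _ 1(1) 2(1)] by simp
    then show "\<exists>q\<in>\<XX>. q \<subseteq> P" using P 1(4)[of P] 2(4)[of P] by argo
  next
    fix P assume P: "primeideal P R \<and> J1 \<cdot> J2 \<subseteq> P"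
    then have "J1 \<subseteq> P \<or> J2 \<subseteq> P" using primeideal_divides_ideal_prod[OF _ 1(2) 2(2)] by simp
    then show "\<exists>q\<in>\<YY>. q \<subseteq> P" using P 1(5)[of P] 2(5)[of P] by argo
  qed
  then show False using L(2) by blast
qed

text \<open>In the localisation at \<open>P\<close>, the element \<open>a\<close> lies in every prime over \<open>L\<close>, so a power of it lies
  in \<open>L\<close>.  Without localising: an ideal over \<open>L\<close> that is maximal among those disjoint from the
  multiplicative set \<open>M\<close> of all \<open>s a\<^sup>k\<close> is a prime contained in \<open>P\<close> that avoids \<open>a\<close>.\<close>

lemma multiple_of_pow_mem:
  assumes L: "ideal L R" and P: "primeideal P R" and a: "a \<in> carrier R"
    and all: "\<And>Q. primeideal Q R \<Longrightarrow> L \<subseteq> Q \<Longrightarrow> Q \<subseteq> P \<Longrightarrow> a \<in> Q"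
  obtains s k where "s \<in> carrier R" "s \<notin> P" "s \<otimes> a [^] (k::nat) \<in> L"
proof -
  define M where "M = {s \<otimes> a [^] k |s (k::nat). s \<in> carrier R - P}"
  have "L \<inter> M \<noteq> {}"
  proof
    assume disj: "L \<inter> M = {}"
    let ?S = "{B. ideal B R \<and> L \<subseteq> B \<and> B \<inter> M = {}}"
    obtain B where B0: "B \<in> ?S" and max: "\<And>N. N \<in> ?S \<Longrightarrow> B \<subseteq> N \<Longrightarrow> N = B"
      using maximal_ideal_in_family[of ?S] L disj by blast
    have B: "ideal B R" "L \<subseteq> B" "B \<inter> M = {}" using B0 by auto
    have memM: "s \<otimes> a [^] k \<in> M" if "s \<in> carrier R" "s \<notin> P" for s and k :: nat
      using that by (auto simp: M_def)
    have "\<one> \<in> M" using memM[of \<one> 0] prime_not_one[OF P] by simp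
    have meets: "\<exists>r\<in>carrier R. \<exists>s\<in>carrier R - P. \<exists>k::nat. s \<otimes> a [^] k \<ominus> r \<otimes> u \<in> B"
      if u: "u \<in> carrier R" "u \<notin> B" for u
    proof -
      have "adjoin B u \<notin> ?S"
        using max[of "adjoin B u"] u mem_adjoin[OF B(1) u(1)] subset_adjoin[OF B(1) u(1)] by blast
      then have "adjoin B u \<inter> M \<noteq> {}"
        using B u adjoin_ideal subset_adjoin[OF B(1) u(1)] by blast
      then show ?thesis using adjoin_iff[OF B(1) u(1)] unfolding M_def by blast
    qed
    have "primeideal B R"
    proof (rule primeidealI)
      show "ideal B R" by (rule B)
      show "cring R" by (rule cring_axioms)
      show "carrier R \<noteq> B" using \<open>\<one> \<in> M\<close> B(3) by auto
      fix u v assume uv: "u \<in> carrier R" "v \<in> carrier R" "u \<otimes> v \<in> B"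
      show "u \<in> B \<or> v \<in> B"
      proof (rule ccontr)
        assume "\<not> (u \<in> B \<or> v \<in> B)"
        then obtain r s k r' s' k' where *: "r \<in> carrier R" "s \<in> carrier R" "s \<notin> P"
            "s \<otimes> a [^] (k::nat) \<ominus> r \<otimes> u \<in> B"
            "r' \<in> carrier R" "s' \<in> carrier R" "s' \<notin> P" "s' \<otimes> a [^] (k'::nat) \<ominus> r' \<otimes> v \<in> B"
          using meets[OF uv(1)] meets[OF uv(2)] by blast
        have pows: "a [^] k \<in> carrier R" "a [^] k' \<in> carrier R" using a by auto
        have "(s \<otimes> s') \<otimes> (a [^] k \<otimes> a [^] k') =
            (s' \<otimes> a [^] k') \<otimes> (s \<otimes> a [^] k \<ominus> r \<otimes> u) \<oplus>
            ((r \<otimes> u) \<otimes> (s' \<otimes> a [^] k' \<ominus> r' \<otimes> v) \<oplus> (r \<otimes> r') \<otimes> (u \<otimes> v))"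
          using *(1,2,5,6) pows uv(1,2) by algebra
        then have "(s \<otimes> s') \<otimes> (a [^] k \<otimes> a [^] k') \<in> B"
          using * pows uv B(1) by (simp add: ideal_add ideal_l_mult)
        moreover have "s \<otimes> s' \<notin> P" using prime_mult_mem[OF P] * by blast
        then have "(s \<otimes> s') \<otimes> a [^] (k + k') \<in> M" using memM * by simp
        ultimately show False using B(3) a by (auto simp: nat_pow_mult)
      qed
    qed
    moreover have "B \<subseteq> P"
    proof
      fix b assume b: "b \<in> B"
      then have "b \<in> carrier R" using ideal_mem_carrier[OF B(1)] by blast
      then show "b \<in> P" using memM[of b 0] b B(3) by auto
    qed
    ultimately have "a \<in> B" using all B(2) by blast
    moreover have "a \<in> M" using memM[of \<one> 1] prime_not_one[OF P] a by simp
    ultimately show False using B(3) by blast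
  qed
  then show ?thesis using that unfolding M_def by blast
qed

text \<open>The square of an element outside \<open>P\<close> is written as \<open>d + e\<close> with \<open>d J = 0 = e I\<close>.  If \<open>d\<close> is
  outside \<open>P\<close>, it is outside the member \<open>p\<close> of \<open>\<XX>\<close> below \<open>P\<close>, so \<open>J\<close> is contained in \<open>p\<close> and \<open>p\<close>
  contains a member of \<open>\<YY>\<close>.  The case of \<open>e\<close> is symmetric.\<close>

lemma no_regular_pair_in_prime:
  assumes primes: "\<And>p. p \<in> \<XX> \<union> \<YY> \<Longrightarrow> primeideal p R"
    and cover: "\<And>Q. primeideal Q R \<Longrightarrow> \<exists>q\<in>\<XX> \<union> \<YY>. q \<subseteq> Q"
    and incomparable: "\<And>p q. p \<in> \<XX> \<Longrightarrow> q \<in> \<YY> \<Longrightarrow> \<not> p \<subseteq> q \<and> \<not> q \<subseteq> p"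
    and P: "primeideal P R" "p \<in> \<XX>" "p \<subseteq> P" "q \<in> \<YY>" "q \<subseteq> P"
    and minimal: "\<And>Q. primeideal Q R \<Longrightarrow> Q \<subseteq> P \<Longrightarrow> \<exists>x\<in>\<XX>. x \<subseteq> Q \<Longrightarrow> \<exists>y\<in>\<YY>. y \<subseteq> Q \<Longrightarrow> Q = P"
    and a: "a \<in> P" "regular_mod {\<zero>} a" and b: "b \<in> P" "regular_mod (PIdl a) b"
  shows False
proof -
  obtain I J where "complementary_mod \<XX> \<YY> {\<zero>} I J"
    using exists_complementary_ideals[of \<XX> \<YY> "{\<zero>}"] cover zeroideal by blast
  note compl = complementary_modD[OF this]
  note I = compl(1,4) and J = compl(2,5)
  have IJ: "x \<otimes> y = \<zero>" if "x \<in> I" "y \<in> J" for x y using compl(3)[OF that] by simp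
  define L where "L = I <+>\<^bsub>R\<^esub> J"
  have sum: "ideal L R" unfolding L_def using add_ideals[OF I(1) J(1)] .
  have sub: "I \<subseteq> L" "J \<subseteq> L" unfolding L_def using subset_ideal_sum I(1) J(1) by blast+
  have all: "c \<in> Q" if "primeideal Q R" "L \<subseteq> Q" "Q \<subseteq> P" "c \<in> P" for c Q
    using that I(2)[of Q] J(2)[of Q] minimal[of Q] sub by blast
  have c: "a \<in> carrier R" "b \<in> carrier R" using a b by (auto simp: regular_mod_def)
  obtain s k where s: "s \<in> carrier R" "s \<notin> P" "s \<otimes> a [^] (k::nat) \<in> L"
    using multiple_of_pow_mem[OF sum P(1) c(1)] all a(1) by blast
  obtain t l where t: "t \<in> carrier R" "t \<notin> P" "t \<otimes> b [^] (l::nat) \<in> L"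
    using multiple_of_pow_mem[OF sum P(1) c(2)] all b(1) by blast
  have pows: "a [^] k \<in> carrier R" "b [^] l \<in> carrier R" using c by auto
  have "(s \<otimes> t) \<otimes> a [^] k = t \<otimes> (s \<otimes> a [^] k)" "(s \<otimes> t) \<otimes> b [^] l = s \<otimes> (t \<otimes> b [^] l)"
    using s(1) t(1) pows by algebra+
  then have st: "s \<otimes> t \<in> carrier R" "(s \<otimes> t) \<otimes> a [^] k \<in> L" "(s \<otimes> t) \<otimes> b [^] l \<in> L"
    using s t ideal_l_mult[OF sum] by auto
  have "s \<otimes> t \<notin> P" using s t prime_mult_mem[OF P(1)] by blast
  obtain d e where de: "d \<in> carrier R" "e \<in> carrier R" "(s \<otimes> t) \<otimes> (s \<otimes> t) = d \<oplus> e"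
    "\<And>y. y \<in> J \<Longrightarrow> d \<otimes> y = \<zero>" "\<And>x. x \<in> I \<Longrightarrow> e \<otimes> x = \<zero>"
  proof (rule square_split_of_regular_pair[OF I(1) J(1) IJ _ _ st[unfolded L_def]])
    show "regular_mod {\<zero>} (a [^] k)" using regular_mod_pow[OF zeroideal a(2)] .
    show "regular_mod (PIdl (a [^] k)) (b [^] l)"
      using regular_mod_pow[OF cgenideal_ideal[OF pows(1)] regular_mod_PIdl_pow[OF a(2) b(2)]] .
  qed auto
  have "d \<oplus> e \<notin> P" using \<open>s \<otimes> t \<notin> P\<close> st(1) prime_mult_mem[OF P(1)] de(3) by metis
  then consider "d \<notin> P" | "e \<notin> P" using ideal_add[OF primeideal.axioms(1)[OF P(1)]] by blast
  then show False
  proof cases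
    case 1
    have pp: "primeideal p R" using primes P by blast
    have "J \<subseteq> p"
    proof
      fix y assume y: "y \<in> J"
      have "d \<otimes> y \<in> p" using de(4)[OF y] ideal_zero[OF primeideal.axioms(1)[OF pp]] by simp
      then show "y \<in> p" using prime_mult_mem[OF pp de(1)] ideal_mem_carrier[OF J(1) y] 1 P(3) by blast
    qed
    then show False using J(2)[OF pp] incomparable[OF P(2)] by blast
  next
    case 2
    have pp: "primeideal q R" using primes P by blast
    have "I \<subseteq> q"
    proof
      fix y assume y: "y \<in> I"
      have "e \<otimes> y \<in> q" using de(5)[OF y] ideal_zero[OF primeideal.axioms(1)[OF pp]] by simp
      then show "y \<in> q" using prime_mult_mem[OF pp de(2)] ideal_mem_carrier[OF I(1) y] 2 P(5) by blast
    qed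
    then show False using I(2)[OF pp] incomparable[OF _ P(4)] by blast
  qed
qed

end

section \<open>Prime ideals and dimension of quotient rings\<close>

text \<open>The lengths of chains of primes in the quotient by \<open>K\<close>, read off in \<open>R\<close>; this also describes
  quotients of quotients without leaving \<open>R\<close>.\<close>

definition chain_above :: "('a, 'b) ring_scheme \<Rightarrow> 'a set \<Rightarrow> nat \<Rightarrow> bool"
  where "chain_above R K n \<longleftrightarrow> (\<exists>f. prime_chain R f n \<and> K \<subseteq> f 0)"

lemma prime_chain_mono:
  assumes "prime_chain R f n" "i \<le> n"
  shows "f 0 \<subseteq> f i"
  using assms(2)
proof (induction i)
  case (Suc i)
  then have "f 0 \<subseteq> f i" "f i \<subset> f (Suc i)" using assms(1) by (auto simp: prime_chain_def)
  then show ?case by blast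
qed simp

context cring
begin

lemma Union_quot_ideal:
  assumes "ideal K R" "ideal N (R Quot K)"
  shows "\<Union>N = {r \<in> carrier R. K +> r \<in> N}"
proof -
  have N: "N \<subseteq> carrier (R Quot K)"
    using assms(2) by (simp add: additive_subgroup.a_subset ideal.axioms(1))
  show ?thesis
    using canonical_proj_vimage_in_carrier[OF assms(1) N] canonical_proj_vimage_mem_iff[OF assms(1) N]
    by blast
qed

lemma image_Union_quot_ideal:
  assumes K: "ideal K R" and N: "ideal N (R Quot K)"
  shows "(+>) K ` \<Union>N = N"
proof -
  have "N \<subseteq> (+>) K ` carrier R"
    using additive_subgroup.a_subset[OF ideal.axioms(1)[OF N]]
    by (auto simp: FactRing_def A_RCOSETS_def')
  then show ?thesis unfolding Union_quot_ideal[OF assms] by auto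
qed

lemma Union_image_ideal:
  "ideal K R \<Longrightarrow> ideal P R \<Longrightarrow> K \<subseteq> P \<Longrightarrow> \<Union>((+>) K ` P) = P"
  using ideal_incl_iff[of K P] by simp

lemma Union_quot_ideal_subset_iff:
  assumes "ideal K R" "ideal M (R Quot K)" "ideal N (R Quot K)"
  shows "\<Union>M \<subseteq> \<Union>N \<longleftrightarrow> M \<subseteq> N"
  using image_Union_quot_ideal[OF assms(1,2)] image_Union_quot_ideal[OF assms(1,3)]
  by (metis Union_mono image_mono)

lemma subset_Union_quot_ideal:
  assumes K: "ideal K R" and N: "ideal N (R Quot K)"
  shows "K \<subseteq> \<Union>N"
proof -
  have "\<zero>\<^bsub>R Quot K\<^esub> \<in> N" using additive_subgroup.zero_closed[OF ideal.axioms(1)[OF N]] .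
  then show ?thesis by (auto simp: FactRing_def)
qed

lemma quot_mult: "ideal K R \<Longrightarrow> a \<in> carrier R \<Longrightarrow> b \<in> carrier R \<Longrightarrow>
    (K +> a) \<otimes>\<^bsub>R Quot K\<^esub> (K +> b) = K +> (a \<otimes> b)"
  by (simp add: FactRing_def ideal.rcoset_mult_add)

lemma quot_carrier: "carrier (R Quot K) = (+>) K ` carrier R"
  by (auto simp: FactRing_def A_RCOSETS_def')

lemma quot_cring: "ideal K R \<Longrightarrow> cring (R Quot K)"
  by (rule ideal.quotient_is_cring[OF _ cring_axioms])

lemma primeideal_Union:
  assumes K: "ideal K R" and Q: "primeideal Q (R Quot K)"
  shows "primeideal (\<Union>Q) R"
proof (rule primeidealI)
  have Qi: "ideal Q (R Quot K)" using Q by (rule primeideal.axioms(1))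
  note U = Union_quot_ideal[OF K Qi]
  show "ideal (\<Union>Q) R" using quot_ideal_imp_ring_ideal[OF K Qi] .
  show "cring R" by (rule cring_axioms)
  show "carrier R \<noteq> \<Union>Q"
  proof
    assume "carrier R = \<Union>Q"
    then have "Q = carrier (R Quot K)"
      using image_Union_quot_ideal[OF K Qi] quot_carrier by metis
    then show False using primeideal.I_notcarr[OF Q] by simp
  qed
  fix a b assume "a \<in> carrier R" "b \<in> carrier R" "a \<otimes> b \<in> \<Union>Q"
  then show "a \<in> \<Union>Q \<or> b \<in> \<Union>Q"
    unfolding U using primeideal.I_prime[OF Q, of "K +> a" "K +> b"]
    by (auto simp: quot_mult[OF K] quot_carrier)
qed

lemma primeideal_image:
  assumes K: "ideal K R" and P: "primeideal P R" "K \<subseteq> P"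
  shows "primeideal ((+>) K ` P) (R Quot K)"
proof (rule primeidealI)
  have Pi: "ideal P R" using P(1) by (rule primeideal.axioms(1))
  show ideal: "ideal ((+>) K ` P) (R Quot K)" using ring_ideal_imp_quot_ideal[OF K Pi] .
  show "cring (R Quot K)" by (rule quot_cring[OF K])
  have mem: "K +> a \<in> (+>) K ` P \<longleftrightarrow> a \<in> P" if "a \<in> carrier R" for a
    using Union_quot_ideal[OF K ideal] Union_image_ideal[OF K Pi P(2)] that by blast
  show "carrier (R Quot K) \<noteq> (+>) K ` P"
    using mem[of \<one>] prime_not_one[OF P(1)] by (auto simp: quot_carrier)
  fix a b assume ab: "a \<in> carrier (R Quot K)" "b \<in> carrier (R Quot K)" "a \<otimes>\<^bsub>R Quot K\<^esub> b \<in> (+>) K ` P"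
  then obtain a' b' where *: "a' \<in> carrier R" "a = K +> a'" "b' \<in> carrier R" "b = K +> b'"
    by (auto simp: quot_carrier)
  then have "a' \<otimes> b' \<in> P" using ab(3) mem quot_mult[OF K] by simp
  then show "a \<in> (+>) K ` P \<or> b \<in> (+>) K ` P"
    using prime_mult_mem[OF P(1)] * mem by blast
qed

lemma chain_above_quot:
  assumes K: "ideal K R" and q: "ideal q (R Quot K)"
  shows "chain_above (R Quot K) q n \<longleftrightarrow> chain_above R (\<Union>q) n"
proof
  assume "chain_above (R Quot K) q n"
  then obtain f where f: "prime_chain (R Quot K) f n" "q \<subseteq> f 0" by (auto simp: chain_above_def)
  have prime: "primeideal (f i) (R Quot K)" if "i \<le> n" for i using f that by (simp add: prime_chain_def)
  have "\<Union>(f i) \<subset> \<Union>(f (Suc i))" if "i < n" for i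
    using f(1) that Union_quot_ideal_subset_iff[OF K] primeideal.axioms(1)[OF prime]
    by (simp add: prime_chain_def psubset_eq) (metis Suc_leI less_imp_le_nat subset_antisym order_refl)
  then have "prime_chain R (\<lambda>i. \<Union>(f i)) n"
    using primeideal_Union[OF K prime] by (simp add: prime_chain_def)
  then show "chain_above R (\<Union>q) n" using f(2) unfolding chain_above_def by blast
next
  assume "chain_above R (\<Union>q) n"
  then obtain f where f: "prime_chain R f n" "\<Union>q \<subseteq> f 0" by (auto simp: chain_above_def)
  have prime: "primeideal (f i) R" "K \<subseteq> f i" if "i \<le> n" for i
    using f that prime_chain_mono[OF f(1) that] subset_Union_quot_ideal[OF K q]
    by (auto simp: prime_chain_def)
  have Un: "\<Union>((+>) K ` f i) = f i" if "i \<le> n" for i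
    using Union_image_ideal[OF K primeideal.axioms(1)] prime[OF that] by blast
  have "(+>) K ` f i \<subset> (+>) K ` f (Suc i)" if "i < n" for i
  proof -
    have "f i \<subset> f (Suc i)" using f(1) that by (simp add: prime_chain_def)
    then show ?thesis using Un[of i] Un[of "Suc i"] that by (metis Suc_leI image_mono less_imp_le_nat psubset_eq)
  qed
  then have "prime_chain (R Quot K) (\<lambda>i. (+>) K ` f i) n"
    using primeideal_image[OF K] prime by (simp add: prime_chain_def)
  moreover have "q \<subseteq> (+>) K ` f 0"
    using image_mono[OF f(2), of "(+>) K"] image_Union_quot_ideal[OF K q] by simp
  ultimately show "chain_above (R Quot K) q n" unfolding chain_above_def by blast
qed

lemma krull_dim_quot:
  assumes K: "ideal K R"
  shows "krull_dim (R Quot K) = Sup {ereal (real n) | n. chain_above R K n}"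
proof -
  interpret Q: cring "R Quot K" using quot_cring[OF K] .
  have zero: "\<zero>\<^bsub>R Quot K\<^esub> = K" by (simp add: FactRing_def)
  have "(\<exists>f. prime_chain (R Quot K) f n) \<longleftrightarrow> chain_above (R Quot K) {K} n" for n
    using Q.ideal_zero[OF primeideal.axioms(1)] by (auto simp: chain_above_def prime_chain_def zero)
  then show ?thesis
    using chain_above_quot[OF K Q.zeroideal[unfolded zero]] by (simp add: krull_dim_def)
qed

lemma krull_dim_quot_quot:
  assumes K: "ideal K R" and q: "ideal q (R Quot K)"
  shows "krull_dim ((R Quot K) Quot q) = Sup {ereal (real n) | n. chain_above R (\<Union>q) n}"
proof -
  interpret Q: cring "R Quot K" using quot_cring[OF K] .
  show ?thesis using Q.krull_dim_quot[OF q] chain_above_quot[OF K q] by simp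
qed

lemma Sup_chain_above:
  assumes "chain_above R K d" "\<And>n. chain_above R K n \<Longrightarrow> n \<le> d"
  shows "Sup {ereal (real n) | n. chain_above R K n} = ereal (real d)"
  using assms by (intro Sup_eqI) auto

lemma minimal_primes_quot:
  assumes K: "ideal K R" and q: "q \<in> minimal_primes (R Quot K)"
  shows "primeideal (\<Union>q) R" "K \<subseteq> \<Union>q"
    and "\<And>P. primeideal P R \<Longrightarrow> K \<subseteq> P \<Longrightarrow> P \<subseteq> \<Union>q \<Longrightarrow> P = \<Union>q"
proof -
  have q': "primeideal q (R Quot K)" "ideal q (R Quot K)"
    using q by (auto simp: minimal_primes_def primeideal.axioms(1))
  show "primeideal (\<Union>q) R" "K \<subseteq> \<Union>q"
    using primeideal_Union[OF K q'(1)] subset_Union_quot_ideal[OF K q'(2)] .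
  fix P assume P: "primeideal P R" "K \<subseteq> P" "P \<subseteq> \<Union>q"
  have "(+>) K ` P \<subseteq> q"
    using image_mono[OF P(3), of "(+>) K"] image_Union_quot_ideal[OF K q'(2)] by simp
  then have "(+>) K ` P = q"
    using q primeideal_image[OF K P(1,2)] by (simp add: minimal_primes_def)
  then show "P = \<Union>q" using Union_image_ideal[OF K primeideal.axioms(1)[OF P(1)] P(2)] by simp
qed

lemma regular_mod_of_quot:
  assumes K: "ideal K R" and x: "x \<in> carrier R" "nonzerodivisor (R Quot K) (K +> x)"
  shows "regular_mod K x"
proof -
  have "y \<in> K" if y: "y \<in> carrier R" "x \<otimes> y \<in> K" for y
  proof -
    have "(K +> x) \<otimes>\<^bsub>R Quot K\<^esub> (K +> y) = \<zero>\<^bsub>R Quot K\<^esub>"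
      using quot_mult[OF K x(1) y(1)] a_rcos_zero[OF K y(2)] by (simp add: FactRing_def)
    then have "K +> y = \<zero>\<^bsub>R Quot K\<^esub>"
      using x(2) y(1) unfolding nonzerodivisor_def quot_carrier by blast
    then have "K +> y = K" by (simp add: FactRing_def)
    then show ?thesis using ideal.rcos_const_imp_mem[OF K y(1)] by simp
  qed
  then show ?thesis using x(1) by (simp add: regular_mod_def)
qed

lemma Idl_insert:
  assumes A: "A \<subseteq> carrier R" and x: "x \<in> carrier R"
  shows "Idl (insert x A) = adjoin (Idl A) x"
proof
  have IA: "ideal (Idl A) R" using A by (rule genideal_ideal)
  show "Idl (insert x A) \<subseteq> adjoin (Idl A) x"
    using adjoin_ideal[OF IA x] mem_adjoin[OF IA x] subset_adjoin[OF IA x] genideal_self[OF A]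
    by (intro genideal_minimal) auto
  have xA: "insert x A \<subseteq> carrier R" using A x by simp
  show "adjoin (Idl A) x \<subseteq> Idl (insert x A)"
    using genideal_self[OF xA] genideal_ideal[OF xA]
    by (intro adjoin_minimal[OF IA x] genideal_minimal) auto
qed

lemma foldl_adjoin: "set xs \<subseteq> carrier R \<Longrightarrow> foldl adjoin {\<zero>} xs = Idl (set xs)"
proof (induction xs rule: rev_induct)
  case Nil
  have "Idl {} \<subseteq> {\<zero>}" by (intro genideal_minimal zeroideal) simp
  then show ?case using ideal_zero[OF genideal_ideal[of "{}"]] by auto
next
  case (snoc x xs)
  then show ?case using Idl_insert[of "set xs" x] by simp
qed

lemma regular_seq_mod_nth:
  assumes "\<And>i. i < length xs \<Longrightarrow> regular_mod (foldl adjoin K (take i xs)) (xs ! i)"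
  shows "regular_seq_mod K xs"
  using assms
proof (induction xs arbitrary: K)
  case (Cons x xs)
  have "regular_mod K x" using Cons.prems[of 0] by simp
  moreover have "regular_mod (foldl adjoin (adjoin K x) (take i xs)) (xs ! i)" if "i < length xs" for i
    using Cons.prems[of "Suc i"] that by simp
  ultimately show ?case using Cons.IH by simp
qed simp

lemma regular_sequence_imp_regular_seq_mod:
  assumes "regular_sequence R xs"
  shows "regular_seq_mod {\<zero>} xs"
proof (rule regular_seq_mod_nth)
  fix i assume i: "i < length xs"
  have car: "set (take i xs) \<subseteq> carrier R" "xs ! i \<in> carrier R"
    using assms nth_mem[OF i] set_take_subset[of i xs] unfolding regular_sequence_def by blast+
  then show "regular_mod (foldl adjoin {\<zero>} (take i xs)) (xs ! i)"
    using assms i regular_mod_of_quot[OF genideal_ideal] by (simp add: regular_sequence_def foldl_adjoin)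
qed

end

lemma (in noetherian_cring) quot_noetherian_ring:
  assumes K: "ideal K R"
  shows "noetherian_ring (R Quot K)"
proof -
  interpret Q: cring "R Quot K" using quot_cring[OF K] .
  show ?thesis
  proof (rule Q.trivial_ideal_chain_imp_noetherian)
    fix C assume C: "C \<noteq> {}" "subset.chain {N. ideal N (R Quot K)} C"
    then have ideals: "ideal N (R Quot K)" if "N \<in> C" for N
      using that by (auto simp: subset.chain_def)
    have "subset.chain {I. ideal I R} (Union ` C)"
      unfolding subset_chain_def
    proof (intro conjI ballI subsetI)
      fix I assume "I \<in> Union ` C"
      then show "I \<in> {I. ideal I R}" using quot_ideal_imp_ring_ideal[OF K] ideals by blast
    next
      fix I J assume "I \<in> Union ` C" "J \<in> Union ` C"
      then obtain M N where MN: "M \<in> C" "N \<in> C" "I = \<Union>M" "J = \<Union>N" by blast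
      then have "M \<subseteq> N \<or> N \<subseteq> M" using C(2) by (auto simp: subset_chain_def)
      then show "I \<subseteq> J \<or> J \<subseteq> I" unfolding MN(3,4) by (meson Union_mono)
    qed
    then have "\<Union>(Union ` C) \<in> Union ` C" using ideal_chain_is_trivial[of "Union ` C"] C(1) by simp
    then obtain N where N: "N \<in> C" "\<Union>(Union ` C) = \<Union>N" by blast
    have "M \<subseteq> N" if "M \<in> C" for M
    proof -
      have "\<Union>M \<subseteq> \<Union>N" unfolding N(2)[symmetric] using that by (intro Union_upper imageI)
      then show ?thesis using Union_quot_ideal_subset_iff[OF K ideals[OF that] ideals[OF N(1)]] by simp
    qed
    then have "\<Union>C = N" using N(1) by blast
    then show "\<Union>C \<in> C" using N(1) by simp
  qed
qed

lemma (in noetherian_local) quot_noetherian_local_ring: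
  assumes K: "ideal K R" "K \<subseteq> m"
  shows "noetherian_local_ring (R Quot K) ((+>) K ` m)"
proof -
  interpret Q: cring "R Quot K" using quot_cring[OF K(1)] .
  let ?n = "(+>) K ` m"
  have n: "primeideal ?n (R Quot K)" using primeideal_image[OF K(1) m_prime K(2)] .
  have below: "N \<subseteq> ?n" if N: "ideal N (R Quot K)" "N \<noteq> carrier (R Quot K)" for N
  proof -
    have "\<one> \<notin> \<Union>N"
    proof
      assume "\<one> \<in> \<Union>N"
      then have "\<Union>N = carrier R"
        using ideal_eq_carrier_iff[OF quot_ideal_imp_ring_ideal[OF K(1) N(1)]] by simp
      then show False using image_Union_quot_ideal[OF K(1) N(1)] N(2) quot_carrier by metis
    qed
    then have "\<Union>N \<subseteq> m"
      using proper_ideal_subset_m[OF quot_ideal_imp_ring_ideal[OF K(1) N(1)]] by simp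
    then show ?thesis
      using image_mono[of "\<Union>N" m "(+>) K"] image_Union_quot_ideal[OF K(1) N(1)] by simp
  qed
  have n_proper: "?n \<noteq> carrier (R Quot K)" using primeideal.I_notcarr[OF n] by simp
  have "maximalideal ?n (R Quot K)"
  proof (rule maximalidealI)
    show "ideal ?n (R Quot K)" using n by (rule primeideal.axioms(1))
    show "carrier (R Quot K) \<noteq> ?n" using n_proper by simp
    show "J = ?n \<or> J = carrier (R Quot K)" if "ideal J (R Quot K)" "?n \<subseteq> J" for J
      using below that by blast
  qed
  moreover have "N = ?n" if N: "maximalideal N (R Quot K)" for N
  proof -
    have "N \<subseteq> ?n" using below maximalideal.axioms(1)[OF N] maximalideal.I_notcarr[OF N] by simp
    then have "?n = N \<or> ?n = carrier (R Quot K)"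
      using maximalideal.I_maximal[OF N] primeideal.axioms(1)[OF n] Q.ideal_subset_carrier by simp
    then show ?thesis using n_proper by simp
  qed
  ultimately show ?thesis
    using Q.cring_axioms quot_noetherian_ring[OF K(1)] unfolding noetherian_local_ring_def by blast
qed

section \<open>Partitions of the associated primes\<close>

context noetherian_local
begin

lemma Ass_eq_assoc_primes: "Ass R = assoc_primes {\<zero>}"
  by (auto simp: Ass_def assoc_primes_def ann_def colon_def)

text \<open>A set of natural numbers that is bounded contains its supremum; it is nonempty here because the
  dimension of a local ring is not \<open>-\<infinity>\<close>.\<close>

lemma exists_regular_seq_of_length_krull_dim:
  assumes depth: "depth R m = krull_dim R"
  obtains xs d where "set xs \<subseteq> m" "regular_seq_mod {\<zero>} xs" "length xs = d"
    "krull_dim R = ereal (real d)" "\<And>f n. prime_chain R f n \<Longrightarrow> n \<le> d"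
proof -
  let ?S = "{ereal (real (length xs)) | xs. set xs \<subseteq> m \<and> regular_sequence R xs}"
  obtain N where N: "\<And>xs. set xs \<subseteq> m \<Longrightarrow> regular_seq_mod {\<zero>} xs \<Longrightarrow> length xs \<le> N"
    using regular_seq_length_bounded[OF zeroideal] ideal_zero[OF m_ideal] by auto
  have upper: "ereal (real n) \<le> krull_dim R" if "prime_chain R f n" for f n
    unfolding krull_dim_def using that by (intro Sup_upper) blast
  have "prime_chain R (\<lambda>_. m) 0" using m_prime by (simp add: prime_chain_def)
  then have "0 \<le> krull_dim R" using upper[of "\<lambda>_. m" 0] by (simp add: zero_ereal_def)
  then have "Sup ?S \<noteq> -\<infinity>" using depth by (auto simp: depth_def)
  moreover have "Sup {} = (-\<infinity> :: ereal)" by (simp add: bot_ereal_def)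
  ultimately have "?S \<noteq> {}" by metis
  have "?S \<subseteq> (\<lambda>n. ereal (real n)) ` {..N}"
    using N regular_sequence_imp_regular_seq_mod by auto
  then have "finite ?S" by (rule finite_subset) simp
  then have "Sup ?S \<in> ?S"
    using Max_in[OF _ \<open>?S \<noteq> {}\<close>] Max_Sup[OF _ \<open>?S \<noteq> {}\<close>] by simp
  then obtain xs where xs: "set xs \<subseteq> m" "regular_sequence R xs" "depth R m = ereal (real (length xs))"
    unfolding depth_def by blast
  show ?thesis
  proof (rule that)
    show "set xs \<subseteq> m" "regular_seq_mod {\<zero>} xs" "length xs = length xs"
      using xs regular_sequence_imp_regular_seq_mod by auto
    show "krull_dim R = ereal (real (length xs))" using xs(3) depth by simp
    show "n \<le> length xs" if "prime_chain R f n" for f n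
      using upper[OF that] xs(3) depth by simp
  qed
qed

end

text \<open>Being Cohen--Macaulay is used in the form that a regular sequence is as long as the longest chain
  of primes.\<close>

locale partitioned_assoc_primes = noetherian_local +
  fixes \<XX> \<YY> :: "'a set set" and I J :: "'a set" and xs d
  assumes xs: "set xs \<subseteq> m" "regular_seq_mod {\<zero>} xs" "length xs = d"
    and dim: "\<And>f n. prime_chain R f n \<Longrightarrow> n \<le> d"
    and nonempty: "\<XX> \<noteq> {}" "\<YY> \<noteq> {}"
    and Ass: "assoc_primes {\<zero>} = \<XX> \<union> \<YY>" and disjoint: "\<XX> \<inter> \<YY> = {}"
    and I_eq: "I = \<Inter>\<XX>" and J_eq: "J = \<Inter>\<YY>"
begin

lemma prime_of_part: "p \<in> \<XX> \<union> \<YY> \<Longrightarrow> primeideal p R"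
  using Ass assoc_prime_ideal by blast

text \<open>A strictly smaller prime would prolong the chain of length \<open>d\<close> that starts at \<open>p\<close>.\<close>

lemma assoc_prime_minimal:
  assumes p: "p \<in> \<XX> \<union> \<YY>" and Q: "primeideal Q R" "Q \<subseteq> p"
  shows "Q = p"
proof (rule ccontr)
  assume "Q \<noteq> p"
  obtain f where f: "prime_chain R f d" "f 0 = p"
    using prime_chain_above_assoc_prime[OF zeroideal _ xs(1,2)] p Ass xs(3) by blast
  then have "prime_chain R (case_nat Q f) (Suc d)"
    using Q \<open>Q \<noteq> p\<close> by (intro prime_chain_Cons) auto
  then show False using dim by fastforce
qed

lemma cover:
  assumes Q: "primeideal Q R"
  shows "\<exists>p\<in>\<XX> \<union> \<YY>. p \<subseteq> Q"
proof -
  have "{\<zero>} \<subseteq> Q" using ideal_zero[OF primeideal.axioms(1)[OF Q]] by simp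
  then show ?thesis using prime_contains_assoc_prime[OF zeroideal Q] Ass by metis
qed

lemma incomparable: "p \<in> \<XX> \<Longrightarrow> q \<in> \<YY> \<Longrightarrow> \<not> p \<subseteq> q \<and> \<not> q \<subseteq> p"
  using assoc_prime_minimal prime_of_part disjoint by (metis UnCI disjoint_iff)

text \<open>There being no inclusions among associated primes, each of them is a maximal annihilator.\<close>

lemma finite_Ass: "finite (\<XX> \<union> \<YY>)"
proof (rule finite_subset)
  show "\<XX> \<union> \<YY> \<subseteq> maximal_colons {\<zero>}"
  proof
    fix p assume p: "p \<in> \<XX> \<union> \<YY>"
    then obtain y where y: "y \<in> carrier R" "p = colon {\<zero>} y" using Ass by (auto simp: assoc_primes_def)
    then have "y \<notin> {\<zero>}"
      using colon_eq_carrier_iff[OF zeroideal y(1)] prime_not_one[OF prime_of_part[OF p]] by auto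
    then obtain q where q: "q \<in> maximal_colons {\<zero>}" "p \<subseteq> q"
      using colon_subset_maximal_colon[OF zeroideal y(1)] y(2) by blast
    then have "q \<in> \<XX> \<union> \<YY>" using maximal_colons_assoc[OF zeroideal] Ass by blast
    then have "p = q" using assoc_prime_minimal[OF _ prime_of_part[OF p] q(2)] by blast
    then show "p \<in> maximal_colons {\<zero>}" using q by simp
  qed
qed (rule finite_maximal_colons[OF zeroideal])

lemma parts_ideal: "ideal I R" "ideal J R"
  unfolding I_eq J_eq using nonempty prime_of_part primeideal.axioms(1) by (auto intro!: i_Intersect)

lemma sum_ideal: "ideal (I <+>\<^bsub>R\<^esub> J) R"
  using parts_ideal by (rule add_ideals)

lemma sum_subset_prime_iff:
  assumes Q: "primeideal Q R"
  shows "I <+>\<^bsub>R\<^esub> J \<subseteq> Q \<longleftrightarrow> (\<exists>p\<in>\<XX>. p \<subseteq> Q) \<and> (\<exists>q\<in>\<YY>. q \<subseteq> Q)"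
proof -
  have contains: "\<Inter>S \<subseteq> Q \<longleftrightarrow> (\<exists>p\<in>S. p \<subseteq> Q)" if S: "S \<subseteq> \<XX> \<union> \<YY>" for S
  proof
    assume "\<Inter>S \<subseteq> Q"
    then show "\<exists>p\<in>S. p \<subseteq> Q"
      using S prime_of_part finite_subset[OF S finite_Ass]
      by (intro prime_contains_of_Inter[OF Q]) (auto intro: primeideal.axioms(1))
  qed blast
  have "I <+>\<^bsub>R\<^esub> J \<subseteq> Q \<longleftrightarrow> I \<subseteq> Q \<and> J \<subseteq> Q"
  proof
    assume "I <+>\<^bsub>R\<^esub> J \<subseteq> Q"
    then show "I \<subseteq> Q \<and> J \<subseteq> Q"
      using order_trans[OF subset_ideal_sum(1)[OF parts_ideal]]
        order_trans[OF subset_ideal_sum(2)[OF parts_ideal]] by simp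
  next
    assume "I \<subseteq> Q \<and> J \<subseteq> Q"
    then have sum: "h \<oplus> k \<in> Q" if "h \<in> I" "k \<in> J" for h k
      using that ideal_add[OF primeideal.axioms(1)[OF Q]] by blast
    show "I <+>\<^bsub>R\<^esub> J \<subseteq> Q"
      unfolding set_add_def' by (intro UN_least) (simp add: sum)
  qed
  then show ?thesis using contains[of \<XX>] contains[of \<YY>] by (simp add: I_eq J_eq)
qed

text \<open>The least prime of such a chain contains members of both parts, which are incomparable, so the
  chain can be prolonged downwards.\<close>

lemma chain_above_sum_bound:
  assumes "chain_above R (I <+>\<^bsub>R\<^esub> J) n"
  shows "n < d"
proof -
  obtain f where f: "prime_chain R f n" "I <+>\<^bsub>R\<^esub> J \<subseteq> f 0" using assms by (auto simp: chain_above_def)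
  then have "primeideal (f 0) R" by (simp add: prime_chain_def)
  then obtain p q where pq: "p \<in> \<XX>" "p \<subseteq> f 0" "q \<in> \<YY>" "q \<subseteq> f 0"
    using f(2) sum_subset_prime_iff by blast
  then have "p \<subset> f 0" using incomparable by blast
  then have "prime_chain R (case_nat p f) (Suc n)"
    using f(1) pq(1) prime_of_part by (intro prime_chain_Cons) auto
  then show ?thesis using dim by fastforce
qed

lemma sum_subset_m: "I <+>\<^bsub>R\<^esub> J \<subseteq> m"
  using nonempty prime_of_part prime_subset_m sum_subset_prime_iff[OF m_prime] by blast

lemma chain_above_sum_0: "chain_above R (I <+>\<^bsub>R\<^esub> J) 0"
  unfolding chain_above_def prime_chain_def using m_prime sum_subset_m
  by (intro exI[of _ "\<lambda>_. m"]) simp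

text \<open>A regular element \<open>a\<close> of \<open>P\<close> exists because \<open>P\<close> contains two incomparable associated primes and
  so lies in none.  By connectedness \<open>P\<close> is contained in an associated prime \<open>r\<close> of \<open>(a)\<close>, and
  exchange provides a regular sequence of length \<open>d - 1\<close> modulo \<open>a\<close>, hence a chain above \<open>r\<close>.\<close>

lemma chain_above_minimal_prime:
  assumes P: "primeideal P R" "I <+>\<^bsub>R\<^esub> J \<subseteq> P"
    and minimal: "\<And>Q. primeideal Q R \<Longrightarrow> I <+>\<^bsub>R\<^esub> J \<subseteq> Q \<Longrightarrow> Q \<subseteq> P \<Longrightarrow> Q = P"
  shows "chain_above R P (d - 1)"
proof -
  have Pi: "ideal P R" using P(1) by (rule primeideal.axioms(1))
  obtain p q where pq: "p \<in> \<XX>" "p \<subseteq> P" "q \<in> \<YY>" "q \<subseteq> P"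
    using P sum_subset_prime_iff by blast
  have "\<not> P \<subseteq> r" if r: "r \<in> assoc_primes {\<zero>}" for r
  proof
    assume "P \<subseteq> r"
    then have "p = r" "q = r"
      using pq r Ass assoc_prime_minimal prime_of_part by (metis UnCI order_trans)+
    then show False using pq disjoint by blast
  qed
  then obtain a where a: "a \<in> P" "regular_mod {\<zero>} a" using exists_regular_mod[OF Pi zeroideal] by blast
  then have ac: "a \<in> carrier R" by (simp add: regular_mod_def)
  have "False" if b: "b \<in> P" "regular_mod (PIdl a) b" for b
  proof (rule no_regular_pair_in_prime[OF _ _ _ P(1) pq _ a b])
    show "Q = P" if "primeideal Q R" "Q \<subseteq> P" "\<exists>x\<in>\<XX>. x \<subseteq> Q" "\<exists>y\<in>\<YY>. y \<subseteq> Q" for Q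
      using minimal sum_subset_prime_iff that by simp
  qed (use prime_of_part cover incomparable in simp_all)
  then obtain r where r: "r \<in> assoc_primes (PIdl a)" "P \<subseteq> r"
    using exists_regular_mod[OF Pi cgenideal_ideal[OF ac]] by metis
  have "a \<in> m" using a(1) prime_subset_m[OF P(1)] by blast
  have "0 < d" using chain_above_sum_bound[OF chain_above_sum_0] .
  then have "length xs = Suc (d - 1)" using xs(3) by simp
  then obtain ys where "set ys \<subseteq> m" "length ys = d - 1" "regular_seq_mod (PIdl a) ys"
    using regular_seq_exchange[OF zeroideal xs(1) _ xs(2) \<open>a \<in> m\<close> a(2), of "d - 1"]
    unfolding adjoin_zero[OF ac] by blast
  then obtain f where "prime_chain R f (d - 1)" "f 0 = r"
    using prime_chain_above_assoc_prime[OF cgenideal_ideal[OF ac] r(1), of ys] by auto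
  then show ?thesis using r(2) by (auto simp: chain_above_def)
qed

text \<open>A longest chain above \<open>I + J\<close> starts at a minimal prime over \<open>I + J\<close>.\<close>

lemma chain_above_sum: "chain_above R (I <+>\<^bsub>R\<^esub> J) (d - 1)"
proof -
  let ?L = "I <+>\<^bsub>R\<^esub> J"
  obtain n where n: "chain_above R ?L n" "\<And>k. chain_above R ?L k \<Longrightarrow> k \<le> n"
    using chain_above_sum_0 chain_above_sum_bound GreatestI_nat[of "chain_above R ?L" 0 d] Greatest_le_nat[of "chain_above R ?L" _ d]
    by (metis less_imp_le_nat)
  then obtain f where f: "prime_chain R f n" "?L \<subseteq> f 0" by (auto simp: chain_above_def)
  have "chain_above R (f 0) (d - 1)"
  proof (rule chain_above_minimal_prime)
    show "primeideal (f 0) R" using f(1) by (simp add: prime_chain_def)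
    show "?L \<subseteq> f 0" by (rule f)
    fix Q assume Q: "primeideal Q R" "?L \<subseteq> Q" "Q \<subseteq> f 0"
    show "Q = f 0"
    proof (rule ccontr)
      assume "Q \<noteq> f 0"
      then have "prime_chain R (case_nat Q f) (Suc n)" using Q f(1) by (intro prime_chain_Cons) auto
      then have "chain_above R ?L (Suc n)" using Q(2) unfolding chain_above_def
        by (intro exI[of _ "case_nat Q f"]) simp
      then show False using n(2) by fastforce
    qed
  qed
  then show ?thesis using f(2) by (auto simp: chain_above_def)
qed

lemma krull_dim_quot_sum: "krull_dim (R Quot (I <+>\<^bsub>R\<^esub> J)) = ereal (real (d - 1))"
  unfolding krull_dim_quot[OF sum_ideal]
  using chain_above_sum chain_above_sum_bound by (intro Sup_chain_above) fastforce+

lemma equidimensional_quot_sum: "equidimensional (R Quot (I <+>\<^bsub>R\<^esub> J))"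
proof -
  have "krull_dim ((R Quot (I <+>\<^bsub>R\<^esub> J)) Quot p) = ereal (real (d - 1))"
    if p: "p \<in> minimal_primes (R Quot (I <+>\<^bsub>R\<^esub> J))" for p
  proof -
    note P = minimal_primes_quot[OF sum_ideal p]
    have "ideal p (R Quot (I <+>\<^bsub>R\<^esub> J))"
      using p by (simp add: minimal_primes_def primeideal.axioms(1))
    moreover have "n \<le> d - 1" if "chain_above R (\<Union>p) n" for n
    proof -
      have "chain_above R (I <+>\<^bsub>R\<^esub> J) n" using that P(2) by (auto simp: chain_above_def)
      then show ?thesis using chain_above_sum_bound by fastforce
    qed
    ultimately show ?thesis
      using krull_dim_quot_quot[OF sum_ideal] Sup_chain_above[OF chain_above_minimal_prime[OF P]] by simp
  qed
  then show ?thesis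
    using quot_cring[OF sum_ideal] quot_noetherian_ring[OF sum_ideal] krull_dim_quot_sum
    by (auto simp: equidimensional_def)
qed

lemma zero_less_dim: "0 < d"
  using chain_above_sum_bound[OF chain_above_sum] by simp

end

theorem proposition1p2:
  fixes R :: "('a, 'b) ring_scheme"
    and m I J :: "'a set" and \<XX> \<YY> :: "'a set set"
  assumes "cohen_macaulay_local_ring R m"
    and "\<XX> \<subseteq> Ass R" and "\<YY> \<subseteq> Ass R"
    and "\<XX> \<noteq> {}" and "\<YY> \<noteq> {}"
    and "Ass R = \<XX> \<union> \<YY>" and "\<XX> \<inter> \<YY> = {}"
    and "I = \<Inter>\<XX>" and "J = \<Inter>\<YY>"
  shows "(\<exists>n. noetherian_local_ring (R Quot (I <+>\<^bsub>R\<^esub> J)) n) \<and>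
         equidimensional (R Quot (I <+>\<^bsub>R\<^esub> J)) \<and>
         krull_dim (R Quot (I <+>\<^bsub>R\<^esub> J)) = krull_dim R - 1"
proof -
  have local: "noetherian_local_ring R m" and depth: "depth R m = krull_dim R"
    using assms(1) by (simp_all add: cohen_macaulay_local_ring_def)
  interpret noetherian_local R m
    using local unfolding noetherian_local_ring_def noetherian_local_def noetherian_cring_def
      noetherian_local_axioms_def by blast
  obtain xs d where xs: "set xs \<subseteq> m" "regular_seq_mod {\<zero>\<^bsub>R\<^esub>} xs" "length xs = d"
    and d: "krull_dim R = ereal (real d)" "\<And>f n. prime_chain R f n \<Longrightarrow> n \<le> d"
    using exists_regular_seq_of_length_krull_dim[OF depth] by blast
  have "assoc_primes {\<zero>\<^bsub>R\<^esub>} = \<XX> \<union> \<YY>" using assms(6) Ass_eq_assoc_primes by simp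
  then interpret partitioned_assoc_primes R m \<XX> \<YY> I J xs d
    using xs d(2) assms(4,5,7-9) by unfold_locales auto
  have "krull_dim R - 1 = ereal (real (d - 1))"
    using d(1) zero_less_dim by (simp add: one_ereal_def of_nat_diff Suc_le_eq)
  then show ?thesis
    using quot_noetherian_local_ring[OF sum_ideal sum_subset_m]
      equidimensional_quot_sum krull_dim_quot_sum by auto
qed

end
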